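(* For positive integers $n,k,q$, let $BS_q(n,k)$ denote the maximum of $BS_q(M)$ over all finite structures $M$ of order $n$ whose vocabulary has maximum relation arity $k$. Then $$BS_k(n,k)<n-\sqrt n+k^2+k.$$ On the other hand, if $n$ is a perfect square, then $BS_q(n,k)\ge n-(q-1)\sqrt n+q$ for every $q\ge2$ and $k\ge2$.
   Context: A vocabulary $L$ is a finite list of relation symbols with positive integer arities; maximum relation arity = largest arity. An $L$-structure $M$ has a finite universe $V(M)$ and relations $R^M:V(M)^l\to\{0,1\}$; its order is $|V(M)|$. A Bernays–Schönfinkel formula is a first-order formula over $L\cup\{=\}$ of the form $\exists y_1\ldots\exists y_p\forall x_1\ldots\forall x_r\,\Psi$ with $p,r\ge0$ and $\Psi$ quantifier-free. A closed formula identifies $M$ of order $n$ if it is true on $M$ and false on every $L$-structure of order $n$ not isomorphic to $M$. $BS_q(M)$ is the minimum total number of quantifiers $p+r$ in a Bernays–Schönfinkel formula with $r\le q$ universal quantifiers that identifies $M$.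
   Formalization: The first bound is stated only for k ≥ 2 or n < 4 (it fails for k = 1, n ≥ 4: n elements with distinct unary colours need n quantifiers), and the second only for n > 1 (for n = 1 the right side is 2 but one quantifier suffices). *)

theory Defs
  imports Complex_Main
begin

text \<open>A vocabulary is the list of the arities of its relation symbols; the symbols are the
  positions \<open>i < length L\<close> of the list.\<close>

definition vocabulary :: "nat list \<Rightarrow> bool" where
  "vocabulary L \<longleftrightarrow> (\<forall>l \<in> set L. 0 < l)"

definition has_max_arity :: "nat list \<Rightarrow> nat \<Rightarrow> bool" where
  "has_max_arity L k \<longleftrightarrow> L \<noteq> [] \<and> Max (set L) = k"

text \<open>\<open>rel M i\<close> is only meaningful on lists over \<open>universe M\<close> whose length is the arity of
  symbol \<open>i\<close>; values elsewhere are never inspected.\<close>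

record 'a struct =
  universe :: "'a set"
  rel :: "nat \<Rightarrow> 'a list \<Rightarrow> bool"

definition has_order :: "'a struct \<Rightarrow> nat \<Rightarrow> bool" where
  "has_order M n \<longleftrightarrow> finite (universe M) \<and> card (universe M) = n"

definition isomorphic :: "nat list \<Rightarrow> 'a struct \<Rightarrow> 'b struct \<Rightarrow> bool" where
  "isomorphic L M N \<longleftrightarrow>
    (\<exists>f. bij_betw f (universe M) (universe N) \<and>
      (\<forall>i < length L. \<forall>as. length as = L ! i \<and> set as \<subseteq> universe M \<longrightarrow>
        rel M i as = rel N i (map f as)))"

datatype fm =
    Bot
  | Eq nat nat
  | Rel nat "nat list"
  | Neg fm
  | And fm fm
  | Or fm fm
  | Ex nat fm
  | All nat fm

fun fm_over :: "nat list \<Rightarrow> fm \<Rightarrow> bool" where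
  "fm_over L Bot \<longleftrightarrow> True"
| "fm_over L (Eq x y) \<longleftrightarrow> True"
| "fm_over L (Rel i xs) \<longleftrightarrow> i < length L \<and> length xs = L ! i"
| "fm_over L (Neg \<phi>) \<longleftrightarrow> fm_over L \<phi>"
| "fm_over L (And \<phi> \<psi>) \<longleftrightarrow> fm_over L \<phi> \<and> fm_over L \<psi>"
| "fm_over L (Or \<phi> \<psi>) \<longleftrightarrow> fm_over L \<phi> \<and> fm_over L \<psi>"
| "fm_over L (Ex x \<phi>) \<longleftrightarrow> fm_over L \<phi>"
| "fm_over L (All x \<phi>) \<longleftrightarrow> fm_over L \<phi>"

fun free_vars :: "fm \<Rightarrow> nat set" where
  "free_vars Bot = {}"
| "free_vars (Eq x y) = {x, y}"
| "free_vars (Rel i xs) = set xs"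
| "free_vars (Neg \<phi>) = free_vars \<phi>"
| "free_vars (And \<phi> \<psi>) = free_vars \<phi> \<union> free_vars \<psi>"
| "free_vars (Or \<phi> \<psi>) = free_vars \<phi> \<union> free_vars \<psi>"
| "free_vars (Ex x \<phi>) = free_vars \<phi> - {x}"
| "free_vars (All x \<phi>) = free_vars \<phi> - {x}"

fun quantifier_free :: "fm \<Rightarrow> bool" where
  "quantifier_free Bot \<longleftrightarrow> True"
| "quantifier_free (Eq x y) \<longleftrightarrow> True"
| "quantifier_free (Rel i xs) \<longleftrightarrow> True"
| "quantifier_free (Neg \<phi>) \<longleftrightarrow> quantifier_free \<phi>"
| "quantifier_free (And \<phi> \<psi>) \<longleftrightarrow> quantifier_free \<phi> \<and> quantifier_free \<psi>"
| "quantifier_free (Or \<phi> \<psi>) \<longleftrightarrow> quantifier_free \<phi> \<and> quantifier_free \<psi>"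
| "quantifier_free (Ex x \<phi>) \<longleftrightarrow> False"
| "quantifier_free (All x \<phi>) \<longleftrightarrow> False"

fun sat :: "'a struct \<Rightarrow> (nat \<Rightarrow> 'a) \<Rightarrow> fm \<Rightarrow> bool" where
  "sat M e Bot \<longleftrightarrow> False"
| "sat M e (Eq x y) \<longleftrightarrow> e x = e y"
| "sat M e (Rel i xs) \<longleftrightarrow> rel M i (map e xs)"
| "sat M e (Neg \<phi>) \<longleftrightarrow> \<not> sat M e \<phi>"
| "sat M e (And \<phi> \<psi>) \<longleftrightarrow> sat M e \<phi> \<and> sat M e \<psi>"
| "sat M e (Or \<phi> \<psi>) \<longleftrightarrow> sat M e \<phi> \<or> sat M e \<psi>"
| "sat M e (Ex x \<phi>) \<longleftrightarrow> (\<exists>a \<in> universe M. sat M (e(x := a)) \<phi>)"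
| "sat M e (All x \<phi>) \<longleftrightarrow> (\<forall>a \<in> universe M. sat M (e(x := a)) \<phi>)"

text \<open>For closed formulas the assignment is irrelevant.\<close>

definition true_on :: "'a struct \<Rightarrow> fm \<Rightarrow> bool" where
  "true_on M \<phi> \<longleftrightarrow> (\<forall>e. sat M e \<phi>)"

text \<open>\<open>bs_formula L p r \<phi>\<close>: \<open>\<phi>\<close> is a closed Bernays--Schoenfinkel formula over \<open>L\<close> with
  \<open>p\<close> existential and \<open>r\<close> universal quantifiers.\<close>

definition bs_formula :: "nat list \<Rightarrow> nat \<Rightarrow> nat \<Rightarrow> fm \<Rightarrow> bool" where
  "bs_formula L p r \<phi> \<longleftrightarrow>
    fm_over L \<phi> \<and> free_vars \<phi> = {} \<and>
    (\<exists>ys xs \<psi>. length ys = p \<and> length xs = r \<and> distinct (ys @ xs) \<and>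
      quantifier_free \<psi> \<and> \<phi> = foldr Ex ys (foldr All xs \<psi>))"

text \<open>Every finite structure has an isomorphic copy inside the natural numbers, so letting the
  competitors \<open>N\<close> have such universes loses nothing.\<close>

definition identifies :: "nat list \<Rightarrow> fm \<Rightarrow> 'a struct \<Rightarrow> bool" where
  "identifies L \<phi> M \<longleftrightarrow>
    true_on M \<phi> \<and>
    (\<forall>N :: nat struct. has_order N (card (universe M)) \<and> \<not> isomorphic L M N \<longrightarrow>
      \<not> true_on N \<phi>)"

definition BS :: "nat \<Rightarrow> nat list \<Rightarrow> 'a struct \<Rightarrow> nat" where
  "BS q L M =
    (LEAST m. \<exists>p r \<phi>. m = p + r \<and> r \<le> q \<and> bs_formula L p r \<phi> \<and> identifies L \<phi> M)"

text \<open>The minimum and the maximum below exist for \<open>n, k \<ge> 1\<close>: a purely existential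
  formula that names all \<open>n\<close> elements identifies \<open>M\<close>, so \<open>BS q L M \<le> n\<close>.\<close>

definition BS_max :: "nat \<Rightarrow> nat \<Rightarrow> nat \<Rightarrow> nat" where
  "BS_max q n k =
    Max {BS q L M | L (M :: nat struct).
          vocabulary L \<and> has_max_arity L k \<and> has_order M n}"

end

theory Submission
  imports Defs "HOL-Combinatorics.Transposition"
begin

text \<open>
  Upper bound.  Name all elements of \<open>M\<close> outside a set \<open>U\<close> existentially and let \<open>k\<close> universal
  variables assert that every \<open>k\<close>-tuple has an atomic type over the named elements that occurs in
  \<open>M\<close>.  This identifies \<open>M\<close> if the elements of \<open>U\<close> have pairwise different types over the
  complement of \<open>U\<close>, and also if all transpositions of elements of \<open>U\<close> are automorphisms.  So it
  suffices to find such a \<open>U\<close> with more than \<open>s = sqrt n - k\<^sup>2\<close> elements.  If some \<open>X\<close> has more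
  than \<open>s\<close> types over it, take one representative of each.  Otherwise start from the empty set and
  repeat \<open>k - 1\<close> times: add blocks of at most \<open>k - 1\<close> elements as long as this increases the number
  of types, then add all type classes with at most \<open>k - 1\<close> elements.  Afterwards no set of \<open>k - 1\<close>
  elements separates two elements of one class, and as at most \<open>2(k - 1)\<^sup>2 s\<close> elements were used,
  some class has more than \<open>s + 1\<close> elements.

  Lower bound.  Take \<open>m\<close> disjoint cliques on \<open>m\<close> vertices each.  If \<open>r\<close> vertices of one clique are
  not named by the existential quantifiers, then \<open>r\<close> universal quantifiers do not notice that an
  unnamed vertex of another clique is moved into it; a single one does not notice that the edge
  between two unnamed vertices is deleted.
\<close>

subsection \<open>Formulas and local embeddings\<close>

lemma sat_cong_free_vars:
  "(\<And>v. v \<in> free_vars \<phi> \<Longrightarrow> e v = e' v) \<Longrightarrow> sat M e \<phi> = sat M e' \<phi>"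
proof (induction \<phi> arbitrary: e e')
  case (Rel i xs)
  then have "map e xs = map e' xs" by auto
  then show ?case by (simp only: sat.simps)
next
  case (Neg \<phi>)
  from Neg.IH[of e e'] Neg.prems show ?case by simp
next
  case (And \<phi> \<psi>)
  from And.IH[of e e'] And.prems show ?case by simp
next
  case (Or \<phi> \<psi>)
  from Or.IH[of e e'] Or.prems show ?case by simp
next
  case (Ex x \<phi>)
  have "sat M (e(x := a)) \<phi> = sat M (e'(x := a)) \<phi>" for a
    by (rule Ex.IH) (use Ex.prems in auto)
  then show ?case by simp
next
  case (All x \<phi>)
  have "sat M (e(x := a)) \<phi> = sat M (e'(x := a)) \<phi>" for a
    by (rule All.IH) (use All.prems in auto)
  then show ?case by simp
qed auto

lemma sat_foldr_Ex:
  "sat M e (foldr Ex vs \<phi>) \<longleftrightarrow>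
    (\<exists>a. a ` set vs \<subseteq> universe M \<and> sat M (override_on e a (set vs)) \<phi>)"
proof (induction vs arbitrary: e)
  case Nil
  then show ?case by simp
next
  case (Cons v vs)
  have "sat M e (foldr Ex (v # vs) \<phi>) \<longleftrightarrow>
      (\<exists>c\<in>universe M. \<exists>a. a ` set vs \<subseteq> universe M \<and>
        sat M (override_on (e(v := c)) a (set vs)) \<phi>)"
    by (simp add: Cons.IH fun_upd_def)
  also have "\<dots> \<longleftrightarrow> (\<exists>a. a ` set (v # vs) \<subseteq> universe M \<and>
      sat M (override_on e a (set (v # vs))) \<phi>)" (is "?L \<longleftrightarrow> ?R")
  proof
    assume ?L
    then obtain c a where ca: "c \<in> universe M" "a ` set vs \<subseteq> universe M"
      "sat M (override_on (e(v := c)) a (set vs)) \<phi>" by blast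
    \<comment> \<open>If \<open>v\<close> recurs in \<open>vs\<close>, the inner choice
      \<open>a\<close> wins; the default \<open>c\<close> takes effect only at a \<open>v\<close>
      outside \<open>vs\<close>.\<close>
    define b where "b = override_on (\<lambda>_. c) a (set vs)"
    have "override_on (e(v := c)) a (set vs) = override_on e b (set (v # vs))"
      by (auto simp: b_def override_on_def fun_eq_iff)
    moreover have "b ` set (v # vs) \<subseteq> universe M"
      using ca by (auto simp: b_def override_on_def)
    ultimately show ?R using ca by metis
  next
    assume ?R
    then obtain a where a: "a ` set (v # vs) \<subseteq> universe M"
      "sat M (override_on e a (set (v # vs))) \<phi>" by blast
    have "override_on (e(v := a v)) a (set vs) = override_on e a (set (v # vs))"
      by (auto simp: override_on_def fun_eq_iff)
    then show ?L using a by (intro bexI[of _ "a v"] exI[of _ a]) auto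
  qed
  finally show ?case .
qed

lemma sat_foldr_Ex_Neg: "sat M e (foldr Ex vs (Neg \<phi>)) \<longleftrightarrow> \<not> sat M e (foldr All vs \<phi>)"
  by (induction vs arbitrary: e) auto

lemma sat_foldr_All:
  "sat M e (foldr All vs \<phi>) \<longleftrightarrow>
    (\<forall>a. a ` set vs \<subseteq> universe M \<longrightarrow> sat M (override_on e a (set vs)) \<phi>)"
  using sat_foldr_Ex_Neg[of M e vs \<phi>] sat_foldr_Ex[of M e vs "Neg \<phi>"] by auto

lemma fm_over_foldr [simp]:
  "fm_over L (foldr Ex vs \<phi>) = fm_over L \<phi>" "fm_over L (foldr All vs \<phi>) = fm_over L \<phi>"
  by (induction vs) auto

lemma free_vars_foldr [simp]:
  "free_vars (foldr Ex vs \<phi>) = free_vars \<phi> - set vs"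
  "free_vars (foldr All vs \<phi>) = free_vars \<phi> - set vs"
  by (induction vs) auto

lemma sat_quantifier_free_transfer:
  assumes "quantifier_free \<psi>" "fm_over L \<psi>" "free_vars \<psi> \<subseteq> W"
    and eq: "\<And>x y. x \<in> W \<Longrightarrow> y \<in> W \<Longrightarrow> e x = e y \<longleftrightarrow> e' x = e' y"
    and rel: "\<And>i xs. i < length L \<Longrightarrow> length xs = L ! i \<Longrightarrow> set xs \<subseteq> W \<Longrightarrow>
      rel M i (map e xs) = rel N i (map e' xs)"
  shows "sat M e \<psi> = sat N e' \<psi>"
  using assms(1-3)
proof (induction \<psi>)
  case (Eq x y)
  then show ?case using eq by simp
next
  case (Rel i xs)
  then show ?case using rel by simp
qed auto

text \<open>Shannon expansion: branch on the truth of \<open>f\<close>, and in each branch apply the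
  induction hypothesis to the property that remains for the truth set within \<open>F\<close>. This
  requires \<open>P\<close> to vary in the induction.\<close>

lemma ex_fm_truth_set:
  assumes "finite F"
    and "\<And>f. f \<in> F \<Longrightarrow> quantifier_free f \<and> fm_over L f \<and> free_vars f \<subseteq> W"
  shows "\<exists>\<phi>. quantifier_free \<phi> \<and> fm_over L \<phi> \<and> free_vars \<phi> \<subseteq> W \<and>
    (\<forall>(N :: 'a struct) e. sat N e \<phi> \<longleftrightarrow> P {f \<in> F. sat N e f})"
  using assms
proof (induction F arbitrary: P rule: finite_induct)
  case empty
  show ?case
    by (rule exI[of _ "if P {} then Neg Bot else Bot"]) simp
next
  case (insert f F)
  obtain \<phi>1 where \<phi>1: "quantifier_free \<phi>1" "fm_over L \<phi>1" "free_vars \<phi>1 \<subseteq> W"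
    "\<And>(N :: 'a struct) e. sat N e \<phi>1 \<longleftrightarrow> P (insert f {f \<in> F. sat N e f})"
    using insert.IH[of "\<lambda>T. P (insert f T)"] insert.prems by auto
  obtain \<phi>2 where \<phi>2: "quantifier_free \<phi>2" "fm_over L \<phi>2" "free_vars \<phi>2 \<subseteq> W"
    "\<And>(N :: 'a struct) e. sat N e \<phi>2 \<longleftrightarrow> P {f \<in> F. sat N e f}"
    using insert.IH[of P] insert.prems by auto
  have split: "{g \<in> insert f F. sat N e g} =
      (if sat N e f then insert f {f \<in> F. sat N e f} else {f \<in> F. sat N e f})"
    for N :: "'a struct" and e by auto
  have "sat N e (Or (And f \<phi>1) (And (Neg f) \<phi>2)) \<longleftrightarrow> P {g \<in> insert f F. sat N e g}"
    for N :: "'a struct" and e unfolding split by (simp add: \<phi>1 \<phi>2)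
  moreover have "quantifier_free f \<and> fm_over L f \<and> free_vars f \<subseteq> W"
    using insert.prems by simp
  ultimately show ?case
    using \<phi>1(1-3) \<phi>2(1-3) by (intro exI[of _ "Or (And f \<phi>1) (And (Neg f) \<phi>2)"]) simp
qed

section \<open>Atomic types and the expressive power of one formula\<close>

definition atoms :: "nat list \<Rightarrow> nat set \<Rightarrow> fm set" where
  "atoms L W = (\<lambda>(x, y). Eq x y) ` (W \<times> W) \<union>
    (\<Union>i<length L. Rel i ` {xs. set xs \<subseteq> W \<and> length xs = L ! i})"

lemma finite_atoms: "finite W \<Longrightarrow> finite (atoms L W)"
  by (auto simp: atoms_def intro: finite_lists_length_eq)

lemma atoms_quantifier_free:
  "f \<in> atoms L W \<Longrightarrow> quantifier_free f \<and> fm_over L f \<and> free_vars f \<subseteq> W"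
  by (auto simp: atoms_def)

text \<open>This is exactly what a Bernays--Schoenfinkel formula with \<open>card S\<close> existential and \<open>r\<close>
  universal quantifiers can say about \<open>N\<close> relative to \<open>M\<close>, with \<open>S\<close> as the existential
  witnesses in \<open>M\<close> and \<open>g ` S\<close> as those in \<open>N\<close>.\<close>

definition locally_embeds ::
  "nat list \<Rightarrow> nat \<Rightarrow> 'a set \<Rightarrow> ('a \<Rightarrow> 'b) \<Rightarrow> 'b struct \<Rightarrow> 'a struct \<Rightarrow> bool" where
  "locally_embeds L r S g N M \<longleftrightarrow>
    (\<forall>B. finite B \<and> B \<subseteq> universe N \<and> card B \<le> r \<longrightarrow>
      (\<exists>\<theta>. inj_on \<theta> (g ` S \<union> B) \<and> \<theta> ` (g ` S \<union> B) \<subseteq> universe M \<and>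
        (\<forall>s \<in> S. \<theta> (g s) = s) \<and>
        (\<forall>i < length L. \<forall>w. length w = L ! i \<and> set w \<subseteq> g ` S \<union> B \<longrightarrow>
          rel N i w = rel M i (map \<theta> w))))"

text \<open>Existential variables name the elements of \<open>S\<close>, and the matrix says that
  the atomic type of the whole assignment also occurs in \<open>M\<close> with these variables at
  \<open>S\<close>. In a model the witnesses define \<open>g\<close>, and an assignment in
  \<open>M\<close> of the same atomic type defines \<open>\<theta>\<close>.\<close>

lemma ex_bs_formula_locally_embeds:
  fixes M :: "'a struct"
  assumes "finite S" and SM: "S \<subseteq> universe M" and "card S = p"
  shows "\<exists>\<phi>. bs_formula L p r \<phi> \<and> true_on M \<phi> \<and>
    (\<forall>N :: 'a struct. universe N \<noteq> {} \<and> true_on N \<phi> \<longrightarrow>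
      (\<exists>g. g ` S \<subseteq> universe N \<and> locally_embeds L r S g N M))"
proof -
  obtain \<sigma> where \<sigma>: "bij_betw \<sigma> {0..<p} S"
    using ex_bij_betw_nat_finite[OF assms(1)] assms(3) by auto
  define ys xs where "ys = [0..<p]" and "xs = [p..<p + r]"
  define W where "W = {..<p + r}"
  have W: "W = set ys \<union> set xs" "set ys \<inter> set xs = {}" "finite W"
    by (auto simp: W_def ys_def xs_def)
  have \<sigma>ys: "\<sigma> ` set ys = S" using \<sigma> by (auto simp: bij_betw_def ys_def)
  \<comment> \<open>\<open>P T\<close> says that \<open>T\<close> is the atomic type of an
    assignment in \<open>M\<close> that reads the existential variables as \<open>S\<close>.\<close>
  define P where "P T \<longleftrightarrow> (\<exists>b. b ` set xs \<subseteq> universe M \<and>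
    T = {f \<in> atoms L W. sat M (override_on \<sigma> b (set xs)) f})" for T
  obtain \<psi> where \<psi>: "quantifier_free \<psi>" "fm_over L \<psi>" "free_vars \<psi> \<subseteq> W"
    "\<And>(N :: 'a struct) e. sat N e \<psi> \<longleftrightarrow> P {f \<in> atoms L W. sat N e f}"
    using ex_fm_truth_set[OF finite_atoms[OF W(3)] atoms_quantifier_free, where P = P and L = L] by blast
  define \<phi> where "\<phi> = foldr Ex ys (foldr All xs \<psi>)"
  have "bs_formula L p r \<phi>"
  proof -
    have "fm_over L \<phi>" "free_vars \<phi> = {}" using \<psi>(2,3) W(1) by (auto simp: \<phi>_def)
    moreover have "length ys = p" "length xs = r" "distinct (ys @ xs)" by (auto simp: ys_def xs_def)
    ultimately show ?thesis unfolding bs_formula_def using \<psi>(1) \<phi>_def by blast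
  qed
  moreover have "true_on M \<phi>"
    unfolding true_on_def \<phi>_def sat_foldr_Ex sat_foldr_All
  proof (intro allI exI[of _ \<sigma>] conjI impI)
    show "\<sigma> ` set ys \<subseteq> universe M" using \<sigma>ys SM by simp
    fix e b assume b: "b ` set xs \<subseteq> universe M"
    have "sat M (override_on (override_on e \<sigma> (set ys)) b (set xs)) f \<longleftrightarrow>
        sat M (override_on \<sigma> b (set xs)) f" if "f \<in> atoms L W" for f
    proof (rule sat_cong_free_vars)
      fix v assume "v \<in> free_vars f"
      with atoms_quantifier_free[OF that] have "v \<in> W" by auto
      then show "override_on (override_on e \<sigma> (set ys)) b (set xs) v =
          override_on \<sigma> b (set xs) v"
        using W by (auto simp: override_on_def)
    qed
    then show "sat M (override_on (override_on e \<sigma> (set ys)) b (set xs)) \<psi>"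
      unfolding \<psi>(4) P_def using b by (intro exI[of _ b]) auto
  qed
  moreover have "\<exists>g. g ` S \<subseteq> universe N \<and> locally_embeds L r S g N M"
    if ne: "universe N \<noteq> {}" and true: "true_on N \<phi>" for N :: "'a struct"
  proof -
    from ne obtain c where c: "c \<in> universe N" by auto
    define e where "e = (\<lambda>_ :: nat. c)"
    from true have "sat N e \<phi>" by (simp add: true_on_def)
    then obtain a where a: "a ` set ys \<subseteq> universe N"
      "\<And>b. b ` set xs \<subseteq> universe N \<Longrightarrow>
        sat N (override_on (override_on e a (set ys)) b (set xs)) \<psi>"
      unfolding \<phi>_def sat_foldr_Ex sat_foldr_All by blast
    define g where "g = a \<circ> inv_into (set ys) \<sigma>"
    have inv: "inv_into (set ys) \<sigma> (\<sigma> v) = v" if "v \<in> set ys" for v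
      using \<sigma> that by (auto simp: ys_def bij_betw_def)
    have g\<sigma>: "g (\<sigma> v) = a v" if "v \<in> set ys" for v
      using inv[OF that] by (simp add: g_def)
    have gS: "g ` S = a ` set ys"
      unfolding \<sigma>ys[symmetric] image_image using g\<sigma> by (rule image_cong[OF refl])
    have "locally_embeds L r S g N M"
      unfolding locally_embeds_def
    proof (intro allI impI, elim conjE)
      fix B assume B: "finite B" "B \<subseteq> universe N" "card B \<le> r"
      obtain h where h: "bij_betw h {0..<card B} B"
        using ex_bij_betw_nat_finite[OF B(1)] by auto
      define b where "b v = (if v - p < card B then h (v - p) else c)" for v
      have bxs: "b ` set xs \<subseteq> universe N"
        using h B(2) c by (auto simp: b_def bij_betw_def)
      have Bb: "B \<subseteq> b ` set xs"
      proof
        fix x assume "x \<in> B"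
        then obtain j where j: "j < card B" "x = h j"
          using h unfolding bij_betw_def by (metis atLeastLessThan_iff image_iff)
        then have "x = b (p + j)" "p + j \<in> set xs" using B(3) by (auto simp: b_def xs_def)
        then show "x \<in> b ` set xs" by blast
      qed
      define e1 where "e1 = override_on (override_on e a (set ys)) b (set xs)"
      from a(2)[OF bxs] have "P {f \<in> atoms L W. sat N e1 f}"
        unfolding \<psi>(4) e1_def .
      then obtain b' where b': "b' ` set xs \<subseteq> universe M"
        "{f \<in> atoms L W. sat N e1 f} =
          {f \<in> atoms L W. sat M (override_on \<sigma> b' (set xs)) f}"
        unfolding P_def by blast
      define e2 where "e2 = override_on \<sigma> b' (set xs)"
      have at: "sat N e1 f \<longleftrightarrow> sat M e2 f" if "f \<in> atoms L W" for f
        using b'(2) that unfolding e2_def by blast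
      have eq: "e1 x = e1 y \<longleftrightarrow> e2 x = e2 y" if "x \<in> W" "y \<in> W" for x y
        using at[of "Eq x y"] that by (auto simp: atoms_def)
      have rel: "rel N i (map e1 zs) = rel M i (map e2 zs)"
        if "i < length L" "length zs = L ! i" "set zs \<subseteq> W" for i zs
        using at[of "Rel i zs"] that by (auto simp: atoms_def)
      \<comment> \<open>Equalities are among the atoms, so \<open>e1\<close> and \<open>e2\<close>
        identify the same variables of \<open>W\<close>. Hence \<open>\<theta>\<close> does not
        depend on the variable picked by \<open>inv_into\<close>, and it is injective.\<close>
      define \<theta> where "\<theta> = e2 \<circ> inv_into W e1"
      have \<theta>: "\<theta> (e1 v) = e2 v" if "v \<in> W" for v
      proof -
        have "inv_into W e1 (e1 v) \<in> W" "e1 (inv_into W e1 (e1 v)) = e1 v"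
          using that by (auto intro: inv_into_into f_inv_into_f)
        then show ?thesis using eq that by (simp add: \<theta>_def)
      qed
      have e1ys: "e1 v = a v" "e2 v = \<sigma> v" if "v \<in> set ys" for v
        using W that by (auto simp: e1_def e2_def override_on_def)
      have e1xs: "e1 v = b v" "e2 v = b' v" if "v \<in> set xs" for v
        using that by (auto simp: e1_def e2_def override_on_def)
      have sub: "g ` S \<union> B \<subseteq> e1 ` W"
      proof -
        have "e1 ` W = a ` set ys \<union> b ` set xs"
          unfolding W(1) image_Un
          by (rule arg_cong2[of _ _ _ _ "(\<union>)"]; rule image_cong[OF refl]; rule e1ys e1xs)
        then show ?thesis using Bb by (simp only: gS Un_mono order_refl)
      qed
      show "\<exists>\<theta>. inj_on \<theta> (g ` S \<union> B) \<and> \<theta> ` (g ` S \<union> B) \<subseteq> universe M \<and>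
        (\<forall>s \<in> S. \<theta> (g s) = s) \<and>
        (\<forall>i < length L. \<forall>w. length w = L ! i \<and> set w \<subseteq> g ` S \<union> B \<longrightarrow>
          rel N i w = rel M i (map \<theta> w))"
      proof (intro exI[of _ \<theta>] conjI)
        have "inj_on \<theta> (e1 ` W)"
          using \<theta> eq by (auto simp: inj_on_def)
        then show "inj_on \<theta> (g ` S \<union> B)" using sub by (rule inj_on_subset)
        have "e2 ` W = S \<union> b' ` set xs"
          unfolding W(1) image_Un \<sigma>ys[symmetric]
          by (rule arg_cong2[of _ _ _ _ "(\<union>)"]; rule image_cong[OF refl]; rule e1ys e1xs)
        then have "e2 ` W \<subseteq> universe M" using b'(1) SM by simp
        moreover have "\<theta> ` e1 ` W = e2 ` W"
          unfolding image_image by (rule image_cong[OF refl \<theta>])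
        ultimately show "\<theta> ` (g ` S \<union> B) \<subseteq> universe M"
          using image_mono[OF sub, of \<theta>] by simp
        show "\<forall>s \<in> S. \<theta> (g s) = s"
        proof
          fix s assume "s \<in> S"
          then obtain v where v: "v \<in> set ys" "s = \<sigma> v" using \<sigma>ys by auto
          have "\<theta> (g s) = \<theta> (e1 v)" using v g\<sigma> e1ys by simp
          also have "\<dots> = e2 v" using \<theta> v W(1) by simp
          finally show "\<theta> (g s) = s" using v e1ys by simp
        qed
        show "\<forall>i < length L. \<forall>w. length w = L ! i \<and> set w \<subseteq> g ` S \<union> B \<longrightarrow>
          rel N i w = rel M i (map \<theta> w)"
        proof (intro allI impI, elim conjE)
          fix i w assume i: "i < length L" and w: "length w = L ! i" "set w \<subseteq> g ` S \<union> B"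
          define zs where "zs = map (inv_into W e1) w"
          have "set w \<subseteq> e1 ` W" using w(2) sub by (rule order_trans)
          then have inW: "inv_into W e1 x \<in> W" "e1 (inv_into W e1 x) = x" if "x \<in> set w" for x
            using that by (auto intro: inv_into_into f_inv_into_f)
          have zs: "set zs \<subseteq> W" "length zs = L ! i" using w(1) inW(1) by (auto simp: zs_def)
          have wz: "w = map e1 zs"
            unfolding zs_def map_map by (rule sym, rule map_idI) (simp add: inW(2))
          have "map \<theta> w = map e2 zs"
            unfolding wz map_map using zs(1) \<theta> by (intro map_cong) auto
          then show "rel N i w = rel M i (map \<theta> w)"
            using rel[OF i zs(2,1)] wz by (simp only:)
        qed
      qed
    qed
    moreover have "g ` S \<subseteq> universe N" using gS a(1) by simp
    ultimately show ?thesis by (intro exI[of _ g] conjI)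
  qed
  ultimately show ?thesis by (intro exI[of _ \<phi>]) simp
qed

text \<open>The converse, with \<open>g = id\<close>: the witnesses in \<open>M\<close> still work
  in \<open>N\<close>, because \<open>\<theta>\<close> carries each choice of the universal
  variables in \<open>N\<close> to one in \<open>M\<close>. Only \<open>card S \<le> p\<close>
  holds, since witnesses may coincide. Lower bounds use this to build competitors.\<close>

lemma bs_formula_true_on_locally_embeds:
  fixes M :: "'a struct"
  assumes "bs_formula L p r \<phi>" "true_on M \<phi>"
  shows "\<exists>S \<subseteq> universe M. finite S \<and> card S \<le> p \<and>
    (\<forall>N :: 'a struct. S \<subseteq> universe N \<and> locally_embeds L r S id N M \<longrightarrow> true_on N \<phi>)"
proof -
  from assms(1) obtain ys xs \<psi> where *: "length ys = p" "length xs = r" "distinct (ys @ xs)"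
    "quantifier_free \<psi>" "\<phi> = foldr Ex ys (foldr All xs \<psi>)" "fm_over L \<phi>" "free_vars \<phi> = {}"
    unfolding bs_formula_def by blast
  define W where "W = set ys \<union> set xs"
  have \<psi>: "fm_over L \<psi>" "free_vars \<psi> \<subseteq> W" using * by (auto simp: W_def)
  fix e :: "nat \<Rightarrow> 'a"
  have "sat M e \<phi>" using assms(2) by (simp add: true_on_def)
  then obtain a where a: "a ` set ys \<subseteq> universe M"
      "\<And>b. b ` set xs \<subseteq> universe M \<Longrightarrow>
        sat M (override_on (override_on e a (set ys)) b (set xs)) \<psi>"
    unfolding *(5) sat_foldr_Ex sat_foldr_All by blast
  define S where "S = a ` set ys"
  have cardS: "card S \<le> p"
    unfolding S_def *(1)[symmetric]
    by (meson List.finite_set card_image_le card_length order_trans)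
  have "true_on N \<phi>" if N: "S \<subseteq> universe N" "locally_embeds L r S id N M"
    for N :: "'a struct"
    unfolding true_on_def *(5) sat_foldr_Ex sat_foldr_All
  proof (intro allI exI[of _ a] conjI impI)
    show "a ` set ys \<subseteq> universe N" using N S_def by simp
    fix e' b assume b: "b ` set xs \<subseteq> universe N"
    have "card (b ` set xs) \<le> r"
      unfolding *(2)[symmetric] by (meson List.finite_set card_image_le card_length order_trans)
    with b N(2) obtain \<theta> where \<theta>: "inj_on \<theta> (S \<union> b ` set xs)"
      "\<theta> ` (S \<union> b ` set xs) \<subseteq> universe M" "\<And>s. s \<in> S \<Longrightarrow> \<theta> s = s"
      "\<And>i w. i < length L \<Longrightarrow> length w = L ! i \<Longrightarrow> set w \<subseteq> S \<union> b ` set xs \<Longrightarrow>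
        rel N i w = rel M i (map \<theta> w)"
      unfolding locally_embeds_def image_id id_apply
      by (metis List.finite_set finite_imageI)
    define e1 where "e1 = override_on (override_on e' a (set ys)) b (set xs)"
    \<comment> \<open>On \<open>W\<close>, \<open>e2\<close> is \<open>\<theta>\<close> after
      \<open>e1\<close>, since \<open>\<theta>\<close> fixes the witnesses.\<close>
    define e2 where "e2 = override_on (override_on e a (set ys)) (\<theta> \<circ> b) (set xs)"
    have "(\<theta> \<circ> b) ` set xs \<subseteq> universe M" using \<theta>(2) by auto
    then have "sat M e2 \<psi>" using a(2) by (simp add: e2_def)
    have e1: "e1 v \<in> S \<union> b ` set xs" "e2 v = \<theta> (e1 v)" if "v \<in> W" for v
      using that \<theta>(3) *(3) by (auto simp: W_def e1_def e2_def override_on_def S_def)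
    have "sat N e1 \<psi> = sat M e2 \<psi>"
    proof (rule sat_quantifier_free_transfer[OF *(4) \<psi>])
      fix x y assume "x \<in> W" "y \<in> W"
      then show "e1 x = e1 y \<longleftrightarrow> e2 x = e2 y"
        using e1 \<theta>(1) by (auto simp: inj_on_eq_iff)
    next
      fix i zs assume i: "i < length L" "length zs = L ! i" "set zs \<subseteq> W"
      have "map e2 zs = map \<theta> (map e1 zs)" using i e1 by auto
      moreover have "set (map e1 zs) \<subseteq> S \<union> b ` set xs" using i(3) e1(1) by auto
      ultimately show "rel N i (map e1 zs) = rel M i (map e2 zs)"
        using \<theta>(4)[of i "map e1 zs"] i by (simp only: length_map)
    qed
    with \<open>sat M e2 \<psi>\<close> show "sat N (override_on (override_on e' a (set ys)) b (set xs)) \<psi>"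
      by (simp add: e1_def)
  qed
  moreover have "finite S" "S \<subseteq> universe M" using a(1) by (simp_all add: S_def)
  ultimately show ?thesis using cardS by (intro exI[of _ S]) simp
qed

section \<open>Reduction of \<open>BS\<close> to local embeddings\<close>

lemma isomorphic_sym:
  assumes "isomorphic L M N"
  shows "isomorphic L N M"
proof -
  from assms obtain f where f: "bij_betw f (universe M) (universe N)"
    "\<And>i as. i < length L \<Longrightarrow> length as = L ! i \<Longrightarrow> set as \<subseteq> universe M \<Longrightarrow>
      rel M i as = rel N i (map f as)"
    unfolding isomorphic_def by blast
  let ?g = "inv_into (universe M) f"
  have g: "bij_betw ?g (universe N) (universe M)" using f(1) by (rule bij_betw_inv_into)
  show ?thesis unfolding isomorphic_def
  proof (intro exI[of _ ?g] conjI allI impI g, elim conjE)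
    fix i as assume as: "i < length L" "length as = L ! i" "set as \<subseteq> universe N"
    have "map f (map ?g as) = as"
      using as(3) f(1) by (auto simp: map_idI bij_betw_inv_into_right subset_iff)
    moreover have "set (map ?g as) \<subseteq> universe M" using as(3) g by (auto simp: bij_betw_def)
    ultimately show "rel N i as = rel M i (map ?g as)"
      using f(2)[of i "map ?g as"] as by simp
  qed
qed

text \<open>Upper bounds on \<open>BS\<close> become a semantic task: find a set \<open>S\<close> to
  name such that local embeddability forces isomorphism. The bound \<open>n \<ge> 1\<close> keeps
  competitors nonempty, as the formula construction requires.\<close>

lemma BS_le_if_locally_determined:
  fixes M :: "nat struct"
  assumes "has_order M n" "n \<ge> 1" "S \<subseteq> universe M" "r \<le> q"
    and det: "\<And>(N :: nat struct) g. has_order N n \<Longrightarrow> g ` S \<subseteq> universe N \<Longrightarrow>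
      locally_embeds L r S g N M \<Longrightarrow> isomorphic L M N"
  shows "\<exists>p \<phi>. p = card S \<and> bs_formula L p r \<phi> \<and> identifies L \<phi> M" "BS q L M \<le> card S + r"
proof -
  have "finite S" using assms(1,3) by (auto simp: has_order_def intro: finite_subset)
  then obtain \<phi> where \<phi>: "bs_formula L (card S) r \<phi>" "true_on M \<phi>"
    "\<And>N :: nat struct. universe N \<noteq> {} \<Longrightarrow> true_on N \<phi> \<Longrightarrow>
      \<exists>g. g ` S \<subseteq> universe N \<and> locally_embeds L r S g N M"
    using ex_bs_formula_locally_embeds[of S M "card S" L r] assms(3) by blast
  have "identifies L \<phi> M"
    unfolding identifies_def
  proof (intro conjI allI impI \<phi>(2), elim conjE)
    fix N :: "nat struct" assume N: "has_order N (card (universe M))" "\<not> isomorphic L M N"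
    then have "has_order N n" "universe N \<noteq> {}" using assms(1,2) by (auto simp: has_order_def)
    then show "\<not> true_on N \<phi>" using \<phi>(3) det N(2) by blast
  qed
  with \<phi>(1) show "\<exists>p \<phi>. p = card S \<and> bs_formula L p r \<phi> \<and> identifies L \<phi> M" by blast
  then show "BS q L M \<le> card S + r"
    unfolding BS_def using assms(4) by (intro Least_le) blast
qed

text \<open>Here \<open>\<theta>\<close> is a left inverse of \<open>g\<close>, so \<open>g\<close>
  is injective, and equal finite cardinalities make it bijective.\<close>

lemma locally_determined_by_universe:
  fixes M N :: "nat struct"
  assumes "has_order M n" "has_order N n" "g ` universe M \<subseteq> universe N"
    "locally_embeds L 0 (universe M) g N M"
  shows "isomorphic L M N"
proof -
  obtain \<theta> where \<theta>: "\<And>s. s \<in> universe M \<Longrightarrow> \<theta> (g s) = s"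
    "\<And>i w. i < length L \<Longrightarrow> length w = L ! i \<Longrightarrow> set w \<subseteq> g ` universe M \<Longrightarrow>
      rel N i w = rel M i (map \<theta> w)"
    using assms(4) unfolding locally_embeds_def
    by (metis Un_empty_right card.empty empty_subsetI finite.emptyI le0)
  have inj: "inj_on g (universe M)" using \<theta>(1) by (metis inj_onI)
  have "g ` universe M = universe N"
    using assms inj by (intro card_subset_eq) (auto simp: has_order_def card_image)
  then have bij: "bij_betw g (universe M) (universe N)" using inj by (simp add: bij_betw_def)
  show ?thesis unfolding isomorphic_def
  proof (intro exI[of _ g] conjI allI impI bij, elim conjE)
    fix i as assume as: "i < length L" "length as = L ! i" "set as \<subseteq> universe M"
    have "map \<theta> (map g as) = as" using as(3) \<theta>(1) by (auto simp: map_idI subset_iff)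
    moreover have "set (map g as) \<subseteq> g ` universe M" using as(3) by auto
    ultimately show "rel M i as = rel N i (map g as)"
      using \<theta>(2)[of i "map g as"] as by simp
  qed
qed

lemma BS_le_order:
  fixes M :: "nat struct"
  assumes "has_order M n" "n \<ge> 1"
  shows "BS q L M \<le> n"
proof -
  have "BS q L M \<le> card (universe M) + 0"
    by (rule BS_le_if_locally_determined(2)[OF assms subset_refl le0])
      (rule locally_determined_by_universe[OF assms(1)])
  then show ?thesis using assms(1) by (simp add: has_order_def)
qed

text \<open>Naming every element without universal quantifiers is a candidate for every
  \<open>q\<close>, so the \<open>LEAST\<close> in \<open>BS\<close> is a genuine minimum.\<close>

lemma BS_attained:
  fixes M :: "nat struct"
  assumes "has_order M n" "n \<ge> 1"
  obtains p r \<phi> where "BS q L M = p + r" "r \<le> q" "bs_formula L p r \<phi>" "identifies L \<phi> M"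
proof -
  have "\<exists>p \<phi>. p = card (universe M) \<and> bs_formula L p 0 \<phi> \<and> identifies L \<phi> M"
    by (rule BS_le_if_locally_determined(1)[OF assms subset_refl le0])
      (rule locally_determined_by_universe[OF assms(1)])
  then have "\<exists>m p r \<phi>. m = p + r \<and> r \<le> q \<and> bs_formula L p r \<phi> \<and> identifies L \<phi> M"
    by (metis le0)
  from LeastI_ex[OF this] show ?thesis
    unfolding BS_def[symmetric] using that by blast
qed

subsection \<open>Types over a set\<close>

text \<open>The type of \<open>a\<close> over \<open>X\<close> is the set of relation instances that hold once every
  placeholder \<open>None\<close> is filled by \<open>a\<close>.\<close>

definition type_over :: "nat list \<Rightarrow> 'a struct \<Rightarrow> 'a set \<Rightarrow> 'a \<Rightarrow> (nat \<times> 'a option list) set"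
  where "type_over L M X a =
    {(i, w). i < length L \<and> length w = L ! i \<and> set w \<subseteq> insert None (Some ` X) \<and>
      rel M i (map (case_option a id) w)}"

lemma type_over_restrict:
  "X \<subseteq> Y \<Longrightarrow> type_over L M X a =
    type_over L M Y a \<inter> {(i, w). set w \<subseteq> insert None (Some ` X)}"
  by (auto simp: type_over_def)

lemma type_over_antimono:
  "X \<subseteq> Y \<Longrightarrow> type_over L M Y a = type_over L M Y b \<Longrightarrow> type_over L M X a = type_over L M X b"
  using type_over_restrict[of X Y L M a] type_over_restrict[of X Y L M b] by simp

text \<open>Turn the occurrences of \<open>a\<close> in \<open>w\<close> into placeholders: filling
  them with \<open>a\<close> restores \<open>w\<close>, filling them with \<open>b\<close> gives the
  replaced list, and equal types treat both fillings alike.\<close>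

lemma rel_replace:
  assumes "type_over L M A a = type_over L M A b" "i < length L" "length w = L ! i"
    "set w \<subseteq> insert a A"
  shows "rel M i w = rel M i (map (\<lambda>z. if z = a then b else z) w)"
proof -
  define w' where "w' = map (\<lambda>z. if z = a then None else Some z) w"
  have w': "length w' = L ! i" "set w' \<subseteq> insert None (Some ` A)"
    using assms(3,4) by (auto simp: w'_def)
  have 1: "map (case_option a id) w' = w" by (auto simp: w'_def map_idI)
  have 2: "map (case_option b id) w' = map (\<lambda>z. if z = a then b else z) w"
    by (auto simp: w'_def)
  have "(i, w') \<in> type_over L M A a \<longleftrightarrow> (i, w') \<in> type_over L M A b" using assms(1) by simp
  then show ?thesis using w' assms(2) by (simp add: type_over_def 1 2)
qed

locale finite_structure =
  fixes L :: "nat list" and M :: "'a struct" and k :: nat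
  assumes finite_universe: "finite (universe M)"
    and arity_le: "i < length L \<Longrightarrow> L ! i \<le> k"
begin

abbreviation "V \<equiv> universe M"
abbreviation "tp \<equiv> type_over L M"

text \<open>Only elements outside \<open>X\<close> count, so that representatives of these types
  form a set disjoint from \<open>X\<close>.\<close>

definition ntypes :: "'a set \<Rightarrow> nat" where
  "ntypes X = card (tp X ` (V - X))"

section \<open>Sets over which type classes no longer split\<close>

text \<open>Greedy growth: while some block of at most \<open>d\<close> elements raises the number
  of types, add it. Each block is paid for by at least one new type, and \<open>u\<close> bounds the
  number of types.\<close>

lemma maximal_extension:
  assumes bound: "\<forall>Y \<subseteq> V. ntypes Y \<le> u" and "X \<subseteq> V"
  shows "\<exists>P. X \<subseteq> P \<and> P \<subseteq> V \<and> card P \<le> card X + d * (ntypes P - ntypes X) \<and>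
    ntypes X \<le> ntypes P \<and> (\<forall>A. A \<subseteq> V \<and> card A \<le> d \<longrightarrow> ntypes (P \<union> A) \<le> ntypes P)"
  using assms(2)
proof (induction "u - ntypes X" arbitrary: X rule: less_induct)
  case less
  show ?case
  proof (cases "\<forall>A. A \<subseteq> V \<and> card A \<le> d \<longrightarrow> ntypes (X \<union> A) \<le> ntypes X")
    case True
    then show ?thesis using less.prems by (intro exI[of _ X]) auto
  next
    case False
    then obtain A where A: "A \<subseteq> V" "card A \<le> d" "ntypes X < ntypes (X \<union> A)"
      by (meson not_le)
    have XA: "X \<union> A \<subseteq> V" using A less.prems by auto
    have "u - ntypes (X \<union> A) < u - ntypes X"
      using bound XA A(3) by (simp add: diff_less_mono2 less_le_trans)
    from less.hyps[OF this XA] obtain P where P: "X \<union> A \<subseteq> P" "P \<subseteq> V"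
      "card P \<le> card (X \<union> A) + d * (ntypes P - ntypes (X \<union> A))" "ntypes (X \<union> A) \<le> ntypes P"
      "\<forall>A. A \<subseteq> V \<and> card A \<le> d \<longrightarrow> ntypes (P \<union> A) \<le> ntypes P"
      by meson
    have "card P \<le> card X + d * (1 + (ntypes P - ntypes (X \<union> A)))"
      using P(3) card_Un_le[of X A] A(2) by (simp add: algebra_simps)
    also have "\<dots> \<le> card X + d * (ntypes P - ntypes X)"
      using A(3) P(4) by (intro add_left_mono mult_le_mono2) linarith
    finally show ?thesis using P A(3) by (intro exI[of _ P]) auto
  qed
qed

text \<open>\<open>P\<close> is maximal in the above sense, and \<open>Q\<close> adds all type
  classes over \<open>P\<close> with at most \<open>d\<close> elements; each of the two stages costs
  at most \<open>d * u\<close>. A small \<open>A\<close> avoiding \<open>Q\<close> cannot swallow a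
  class, so every type over \<open>P\<close> survives outside \<open>A\<close>; as \<open>A\<close>
  does not raise the number of types, it splits no class.\<close>

lemma refinement_step:
  assumes bound: "\<forall>Y \<subseteq> V. ntypes Y \<le> u" and X: "X \<subseteq> V"
  shows "\<exists>P Q. X \<subseteq> P \<and> P \<subseteq> Q \<and> Q \<subseteq> V \<and> card Q \<le> card X + 2 * d * u \<and>
    (\<forall>A a b. A \<subseteq> V - Q \<and> card A \<le> d \<and> a \<in> V - (P \<union> A) \<and> b \<in> V - (P \<union> A) \<and>
      tp P a = tp P b \<longrightarrow> tp (P \<union> A) a = tp (P \<union> A) b)"
proof -
  obtain P where P: "X \<subseteq> P" "P \<subseteq> V" "card P \<le> card X + d * (ntypes P - ntypes X)"
    "\<And>A. A \<subseteq> V \<Longrightarrow> card A \<le> d \<Longrightarrow> ntypes (P \<union> A) \<le> ntypes P"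
    using maximal_extension[OF bound X, of d] by meson
  define fib where "fib t = {b \<in> V - P. tp P b = t}" for t
  define small where "small = {t \<in> tp P ` (V - P). card (fib t) \<le> d}"
  define Q where "Q = P \<union> (\<Union>t\<in>small. fib t)"
  have finV: "finite (V - P)" using finite_universe by simp
  have fin: "finite small" using finV by (simp add: small_def)
  have "card (\<Union>t\<in>small. fib t) \<le> (\<Sum>t\<in>small. card (fib t))" by (rule card_UN_le[OF fin])
  also have "\<dots> \<le> card small * d"
    using sum_bounded_above[of small "\<lambda>t. card (fib t)" d] by (simp add: small_def)
  also have "\<dots> \<le> ntypes P * d"
    unfolding ntypes_def small_def using finV by (intro mult_le_mono1 card_mono) auto
  also have "\<dots> \<le> d * u" using bound P(2) by simp
  finally have "card (\<Union>t\<in>small. fib t) \<le> d * u" .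
  moreover have "card P \<le> card X + d * u"
  proof -
    have "ntypes P - ntypes X \<le> u" using bound P(2) by (meson diff_le_self le_trans)
    then show ?thesis using P(3) by (meson add_left_mono le_trans mult_le_mono2)
  qed
  ultimately have cardQ: "card Q \<le> card X + 2 * d * u"
    unfolding Q_def using card_Un_le[of P "\<Union>t\<in>small. fib t"] by linarith
  have "tp (P \<union> A) a = tp (P \<union> A) b"
    if A: "A \<subseteq> V - Q" "card A \<le> d" and ab: "a \<in> V - (P \<union> A)" "b \<in> V - (P \<union> A)"
      and eq: "tp P a = tp P b" for A a b
  proof -
    define T where "T = tp (P \<union> A) ` (V - (P \<union> A))"
    \<comment> \<open>\<open>\<rho>\<close> forgets the parameters outside \<open>P\<close>, mapping
      types over \<open>P \<union> A\<close> to types over \<open>P\<close>.\<close>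
    define \<rho> where "\<rho> t = t \<inter> {(i, w). set w \<subseteq> insert None (Some ` P)}"
      for t :: "(nat \<times> 'a option list) set"
    have \<rho>: "\<rho> (tp (P \<union> A) c) = tp P c" for c
      unfolding \<rho>_def by (rule type_over_restrict[symmetric]) simp
    have finT: "finite T" unfolding T_def using finite_universe by simp
    have "tp P ` (V - P) \<subseteq> \<rho> ` T"
    proof
      fix t assume t: "t \<in> tp P ` (V - P)"
      then obtain c where c: "c \<in> V - P" "t = tp P c" by blast
      \<comment> \<open>A class inside \<open>A\<close> would have at most \<open>d\<close> elements
        and thus lie in \<open>Q\<close>, which \<open>A\<close> avoids.\<close>
      have "\<not> fib t \<subseteq> A"
      proof
        assume sub: "fib t \<subseteq> A"
        moreover have "finite A" using A(1) finite_universe by (meson finite_Diff finite_subset)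
        ultimately have "card (fib t) \<le> d" using A(2) by (meson card_mono le_trans)
        then have "fib t \<subseteq> Q" using t by (auto simp: small_def Q_def)
        moreover have "c \<in> fib t" using c by (simp add: fib_def)
        ultimately show False using sub A(1) by blast
      qed
      then obtain c' where "c' \<in> V - (P \<union> A)" "tp P c' = t" by (auto simp: fib_def)
      then show "t \<in> \<rho> ` T" using \<rho>[of c'] unfolding T_def by (metis image_eqI)
    qed
    then have "card (tp P ` (V - P)) \<le> card (\<rho> ` T)" using finT by (intro card_mono) auto
    \<comment> \<open>Maximality of \<open>P\<close>: \<open>\<rho>\<close> maps onto at least as
      many types as \<open>T\<close> has, so it is injective on \<open>T\<close>.\<close>
    moreover have "card T \<le> card (tp P ` (V - P))"
      using P(4)[of A] A by (auto simp: ntypes_def T_def)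
    ultimately have "card (\<rho> ` T) = card T" using card_image_le[OF finT, of \<rho>] by linarith
    then have "inj_on \<rho> T" using finT by (rule eq_card_imp_inj_on[rotated])
    moreover have "\<rho> (tp (P \<union> A) a) = \<rho> (tp (P \<union> A) b)" using \<rho> eq by simp
    ultimately show ?thesis using ab by (auto simp: T_def inj_on_def)
  qed
  moreover have "P \<subseteq> Q" "Q \<subseteq> V" using P(2) by (auto simp: Q_def fib_def)
  ultimately show ?thesis using P(1) cardQ by (intro exI[of _ P] exI[of _ Q] conjI allI impI) simp_all
qed

text \<open>Each round of refinement rules out distinguishing sets \<open>A\<close> that avoid its ring \<open>Q - X\<close>,
  so a surviving \<open>A\<close> meets one more ring per round.\<close>

lemma iterated_refinement:
  assumes bound: "\<forall>Y \<subseteq> V. ntypes Y \<le> u"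
  shows "\<exists>X \<subseteq> V. card X \<le> 2 * d * u * j \<and>
    (\<forall>A a b. A \<subseteq> V \<and> card A \<le> d \<and> a \<in> V - (X \<union> A) \<and> b \<in> V - (X \<union> A) \<and>
      tp X a = tp X b \<and> (card (A \<inter> X) < j \<or> A \<subseteq> X) \<longrightarrow> tp A a = tp A b)"
proof (induction j)
  case 0
  show ?case by (intro exI[of _ "{}"]) auto
next
  case (Suc j)
  then obtain X where X: "X \<subseteq> V" "card X \<le> 2 * d * u * j"
    "\<And>A a b. A \<subseteq> V \<Longrightarrow> card A \<le> d \<Longrightarrow> a \<in> V - (X \<union> A) \<Longrightarrow> b \<in> V - (X \<union> A) \<Longrightarrow>
      tp X a = tp X b \<Longrightarrow> card (A \<inter> X) < j \<Longrightarrow> tp A a = tp A b"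
    by meson
  obtain P Q where Q: "X \<subseteq> P" "P \<subseteq> Q" "Q \<subseteq> V" "card Q \<le> card X + 2 * d * u"
    "\<And>A a b. A \<subseteq> V - Q \<Longrightarrow> card A \<le> d \<Longrightarrow> a \<in> V - (P \<union> A) \<Longrightarrow> b \<in> V - (P \<union> A) \<Longrightarrow>
      tp P a = tp P b \<Longrightarrow> tp (P \<union> A) a = tp (P \<union> A) b"
    using refinement_step[OF bound X(1), of d] by meson
  have "tp A a = tp A b"
    if A: "A \<subseteq> V" "card A \<le> d" and ab: "a \<in> V - (Q \<union> A)" "b \<in> V - (Q \<union> A)"
      and eq: "tp Q a = tp Q b" and meet: "card (A \<inter> Q) < Suc j \<or> A \<subseteq> Q" for A a b
  proof (cases "A \<subseteq> Q")
    case True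
    then show ?thesis using eq by (rule type_over_antimono)
  next
    case False
    have finA: "finite A" using A(1) finite_universe by (rule finite_subset)
    show ?thesis
    proof (cases "A \<inter> (Q - X) = {}")
      \<comment> \<open>\<open>A\<close> avoids the ring, so \<open>A\<close> lies in
        \<open>P \<union> (A - Q)\<close>, and the part \<open>A - Q\<close> separates nothing over
        \<open>P\<close>.\<close>
      case True
      have "card (A - Q) \<le> d" using A(2) finA by (meson Diff_subset card_mono le_trans)
      moreover have "tp P a = tp P b" using type_over_antimono[OF Q(2) eq] .
      ultimately have "tp (P \<union> (A - Q)) a = tp (P \<union> (A - Q)) b"
        using A(1) ab Q(2) by (intro Q(5)) auto
      moreover have "A \<subseteq> P \<union> (A - Q)" using True Q(1) by auto
      ultimately show ?thesis by (metis type_over_antimono)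
    next
      \<comment> \<open>\<open>A\<close> meets the ring, so it has fewer elements in
        \<open>X\<close> than in \<open>Q\<close>, and the induction hypothesis for \<open>j\<close>
        applies.\<close>
      case ring: False
      have "A \<inter> X \<subset> A \<inter> Q" using ring Q(1,2) by blast
      then have "card (A \<inter> X) < card (A \<inter> Q)" using finA by (intro psubset_card_mono) auto
      then have "card (A \<inter> X) < j" using meet False by linarith
      moreover have "tp X a = tp X b" by (rule type_over_antimono[OF order_trans[OF Q(1,2)] eq])
      moreover have "a \<in> V - (X \<union> A)" "b \<in> V - (X \<union> A)"
        using ab order_trans[OF Q(1,2)] by auto
      ultimately show ?thesis using X(3)[OF A] by metis
    qed
  qed
  moreover have "card Q \<le> 2 * d * u * Suc j" using Q(4) X(2) by simp
  ultimately show ?case using Q(3) by (intro exI[of _ Q] conjI allI impI) simp_all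
qed

text \<open>After \<open>d\<close> rounds the side condition always holds: if at least
  \<open>d\<close> elements of \<open>A\<close> lie in \<open>X\<close>, then all do, since
  \<open>card A \<le> d\<close>.\<close>

lemma ex_refining_set:
  assumes "\<forall>Y \<subseteq> V. ntypes Y \<le> u"
  shows "\<exists>X \<subseteq> V. card X \<le> 2 * d * u * d \<and>
    (\<forall>A a b. A \<subseteq> V \<and> card A \<le> d \<and> a \<in> V - (X \<union> A) \<and> b \<in> V - (X \<union> A) \<and>
      tp X a = tp X b \<longrightarrow> tp A a = tp A b)"
proof -
  have "card (A \<inter> X) < d \<or> A \<subseteq> X" if "A \<subseteq> V" "card A \<le> d" for A X
  proof (rule ccontr)
    assume "\<not> (card (A \<inter> X) < d \<or> A \<subseteq> X)"
    then have "A \<inter> X \<subset> A" "card (A \<inter> X) \<ge> d" by auto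
    moreover have "finite A" using that(1) finite_universe by (rule finite_subset)
    ultimately show False using that(2) psubset_card_mono[of A "A \<inter> X"] by linarith
  qed
  then show ?thesis using iterated_refinement[OF assms, where d = d and j = d] by meson
qed

section \<open>Automorphisms that move only a twin class\<close>

text \<open>If only one of \<open>a\<close>, \<open>b\<close> occurs in \<open>w\<close>, the other
  entries form at most \<open>k - 1\<close> parameters, over which the two have equal types. If both
  occur, \<open>card C > k\<close> leaves a fresh \<open>c\<close> in \<open>C\<close>, and the swap
  is done in three such moves.\<close>

lemma rel_transpose:
  assumes C: "C \<subseteq> V" "card C > k"
    and twins: "\<forall>A a b. A \<subseteq> V \<and> card A \<le> k - 1 \<and> a \<in> C - A \<and> b \<in> C - A \<longrightarrow>
      tp A a = tp A b"
    and w: "i < length L" "length w = L ! i" "set w \<subseteq> V"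
    and ab: "a \<in> C" "b \<in> C"
  shows "rel M i w = rel M i (map (transpose a b) w)"
proof -
  have move: "rel M i w = rel M i (map (transpose a b) w)"
    if w: "length w = L ! i" "set w \<subseteq> V" and ab: "a \<in> C" "b \<in> C" "b \<notin> set w" for w a b
  proof (cases "a \<in> set w")
    case True
    have "card (set w) \<le> k" using card_length[of w] w(1) arity_le[OF assms(4)] by simp
    then have "card (set w - {a}) \<le> k - 1" using True by simp
    then have "tp (set w - {a}) a = tp (set w - {a}) b" using w ab by (intro twins[rule_format]) auto
    from rel_replace[OF this assms(4) w(1)]
    have "rel M i w = rel M i (map (\<lambda>z. if z = a then b else z) w)" by auto
    also have "map (\<lambda>z. if z = a then b else z) w = map (transpose a b) w"
      using ab(3) by (auto simp: transpose_def)
    finally show ?thesis .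
  next
    case False
    then have "map (transpose a b) w = w"
      using ab(3) by (intro map_idI) (auto simp: transpose_def)
    then show ?thesis by simp
  qed
  show ?thesis
  proof (cases "a \<in> set w \<and> b \<in> set w \<and> a \<noteq> b")
    case False
    then consider "a = b" | "b \<notin> set w" | "a \<notin> set w" by blast
    then show ?thesis
    proof cases
      case 1
      then show ?thesis by simp
    next
      case 2
      then show ?thesis by (rule move[OF w(2,3) ab])
    next
      case 3
      then show ?thesis
        using move[OF w(2,3) ab(2,1)] by (simp add: transpose_commute[of a b])
    qed
  next
    case True
    have "card (set w) \<le> k" using card_length[of w] w(2) arity_le[OF w(1)] by simp
    then have "\<not> C \<subseteq> set w" using C(2) card_mono[of "set w" C] by auto
    then obtain c where c: "c \<in> C" "c \<notin> set w" by auto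
    \<comment> \<open>Move \<open>a\<close> to \<open>c\<close>, then \<open>b\<close> to
      \<open>a\<close>, then \<open>c\<close> to \<open>b\<close>; each target is absent when it is
      used.\<close>
    define w1 where "w1 = map (transpose a c) w"
    define w2 where "w2 = map (transpose b a) w1"
    define w3 where "w3 = map (transpose c b) w2"
    have w1: "length w1 = L ! i" "set w1 \<subseteq> V" "a \<notin> set w1"
      using w c C(1) True by (auto simp: w1_def transpose_def)
    have w2: "length w2 = L ! i" "set w2 \<subseteq> V" "b \<notin> set w2"
      using w1 ab C(1) True by (auto simp: w2_def transpose_def)
    have "rel M i w = rel M i w1" unfolding w1_def using move[OF w(2,3) ab(1) c] .
    also have "\<dots> = rel M i w2" unfolding w2_def using move[OF w1(1,2) ab(2,1) w1(3)] .
    also have "\<dots> = rel M i w3" unfolding w3_def using move[OF w2(1,2) c(1) ab(2) w2(3)] .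
    also have "w3 = map (transpose a b) w"
      using c True unfolding w3_def w2_def w1_def by (auto simp: transpose_def)
    finally show ?thesis .
  qed
qed

text \<open>An injection that moves entries only within \<open>C\<close> factors into transpositions
  of \<open>C\<close>. The induction is on the number of moved entries.\<close>

lemma rel_exchange:
  assumes "C \<subseteq> V"
    and transp: "\<And>w a b. length w = L ! i \<Longrightarrow> set w \<subseteq> V \<Longrightarrow> a \<in> C \<Longrightarrow> b \<in> C \<Longrightarrow>
      rel M i w = rel M i (map (transpose a b) w)"
    and "length w = L ! i" "set w \<subseteq> V" "inj_on \<pi> (set w)"
      "\<And>x. x \<in> set w \<Longrightarrow> \<pi> x \<noteq> x \<Longrightarrow> x \<in> C \<and> \<pi> x \<in> C"
  shows "rel M i w = rel M i (map \<pi> w)"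
  using assms(3-)
proof (induction "card {x \<in> set w. \<pi> x \<noteq> x}" arbitrary: w \<pi> rule: less_induct)
  case less
  show ?case
  proof (cases "\<forall>x \<in> set w. \<pi> x = x")
    case True
    then have "map \<pi> w = w" by (simp add: map_idI)
    then show ?thesis by simp
  next
    case False
    then obtain z where z: "z \<in> set w" "\<pi> z \<noteq> z" by auto
    \<comment> \<open>Apply first the transposition that brings \<open>z\<close> to its goal. The
      remaining map \<open>\<pi>'\<close> fixes \<open>\<pi> z\<close>, and by injectivity of
      \<open>\<pi>\<close> no fixed entry starts to move.\<close>
    define \<tau> where "\<tau> = transpose z (\<pi> z)"
    have \<tau>\<tau>: "\<tau> (\<tau> x) = x" for x by (simp add: \<tau>_def)
    have zC: "z \<in> C" "\<pi> z \<in> C" using less.prems(4) z by auto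
    define w' where "w' = map \<tau> w"
    define \<pi>' where "\<pi>' = \<pi> \<circ> \<tau>"
    have moved: "\<pi> x \<noteq> x" if "x \<in> set w" "\<pi> x \<noteq> \<tau> x" for x
    proof
      assume x: "\<pi> x = x"
      then have "x = z \<or> x = \<pi> z" using that(2) by (auto simp: \<tau>_def transpose_def split: if_splits)
      then have "x = z" using x z(1) that(1) less.prems(3) by (metis inj_onD)
      then show False using x z(2) by simp
    qed
    have "{x \<in> set w'. \<pi>' x \<noteq> x} = \<tau> ` {x \<in> set w. \<pi> x \<noteq> \<tau> x}"
      by (auto simp: w'_def \<pi>'_def \<tau>\<tau>)
    moreover have "card \<dots> = card {x \<in> set w. \<pi> x \<noteq> \<tau> x}"
      by (rule card_image) (metis \<tau>\<tau> inj_onI)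
    moreover have "{x \<in> set w. \<pi> x \<noteq> \<tau> x} \<subset> {x \<in> set w. \<pi> x \<noteq> x}"
    proof (rule psubsetI)
      show "{x \<in> set w. \<pi> x \<noteq> \<tau> x} \<subseteq> {x \<in> set w. \<pi> x \<noteq> x}" using moved by blast
      have "z \<in> {x \<in> set w. \<pi> x \<noteq> x}" "z \<notin> {x \<in> set w. \<pi> x \<noteq> \<tau> x}"
        using z by (simp_all add: \<tau>_def)
      then show "{x \<in> set w. \<pi> x \<noteq> \<tau> x} \<noteq> {x \<in> set w. \<pi> x \<noteq> x}" by metis
    qed
    ultimately have dec: "card {x \<in> set w'. \<pi>' x \<noteq> x} < card {x \<in> set w. \<pi> x \<noteq> x}"
      by (simp add: psubset_card_mono)
    have "rel M i w = rel M i w'"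
      unfolding w'_def \<tau>_def using less.prems zC by (intro transp) auto
    also have "\<dots> = rel M i (map \<pi>' w')"
    proof (rule less.hyps[OF dec])
      show "length w' = L ! i" using less.prems by (simp add: w'_def)
      show "set w' \<subseteq> V"
        using less.prems(2) zC assms(1) by (auto simp: w'_def \<tau>_def transpose_def)
      show "inj_on \<pi>' (set w')"
        using less.prems(3) by (auto simp: inj_on_def w'_def \<pi>'_def \<tau>\<tau>)
      fix x assume x: "x \<in> set w'" "\<pi>' x \<noteq> x"
      then obtain y where y: "y \<in> set w" "x = \<tau> y" "\<pi> y \<noteq> \<tau> y"
        by (auto simp: w'_def \<pi>'_def \<tau>\<tau>)
      then have "y \<in> C \<and> \<pi> y \<in> C" using moved less.prems(4) by blast
      then show "x \<in> C \<and> \<pi>' x \<in> C"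
        using y zC by (auto simp: \<pi>'_def \<tau>\<tau>) (auto simp: \<tau>_def transpose_def)
    qed
    also have "map \<pi>' w' = map \<pi> w" by (simp add: w'_def \<pi>'_def \<tau>\<tau>)
    finally show ?thesis .
  qed
qed

section \<open>From local embeddings to isomorphisms\<close>

text \<open>The global map inverts \<open>g\<close> on the named elements and is \<open>h\<close>
  elsewhere. A tuple has at most \<open>k\<close> entries, so one local embedding
  \<open>\<theta>\<close> covers it, and \<open>agree\<close> states that replacing
  \<open>\<theta>\<close> by the global map does not change the relation.\<close>

lemma isomorphic_if_locally_embeds:
  assumes N: "finite (universe N)" "card (universe N) = card V"
    and S: "S \<subseteq> V" and g: "g ` S \<subseteq> universe N"
    and emb: "locally_embeds L k S g N M"
    and h: "inj_on h (universe N - g ` S)" "h ` (universe N - g ` S) \<subseteq> V - S"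
    and agree: "\<And>B \<theta> i w. B \<subseteq> universe N - g ` S \<Longrightarrow> card B \<le> k \<Longrightarrow>
      inj_on \<theta> (g ` S \<union> B) \<Longrightarrow> \<theta> ` (g ` S \<union> B) \<subseteq> V \<Longrightarrow>
      (\<And>s. s \<in> S \<Longrightarrow> \<theta> (g s) = s) \<Longrightarrow>
      (\<And>i w. i < length L \<Longrightarrow> length w = L ! i \<Longrightarrow> set w \<subseteq> g ` S \<union> B \<Longrightarrow>
          rel N i w = rel M i (map \<theta> w)) \<Longrightarrow>
      i < length L \<Longrightarrow> length w = L ! i \<Longrightarrow> set w \<subseteq> g ` S \<union> B \<Longrightarrow>
      rel M i (map \<theta> w) = rel M i (map (\<lambda>x. if x \<in> g ` S then \<theta> x else h x) w)"
  shows "isomorphic L M N"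
proof -
  obtain \<theta>0 where \<theta>0: "\<And>s. s \<in> S \<Longrightarrow> \<theta>0 (g s) = s"
    using emb[unfolded locally_embeds_def, rule_format, of "{}"] by auto
  define f where "f x = (if x \<in> g ` S then \<theta>0 x else h x)" for x
  have fS: "f x \<in> S" if "x \<in> g ` S" for x using that \<theta>0 by (auto simp: f_def)
  have fU: "f x \<in> V - S" if "x \<in> universe N - g ` S" for x
    using that h(2) by (auto simp: f_def)
  have "inj_on f (universe N)"
  proof (rule inj_onI)
    fix x y assume xy: "x \<in> universe N" "y \<in> universe N" "f x = f y"
    then have "x \<in> g ` S \<longleftrightarrow> y \<in> g ` S" using fS fU by (metis Diff_iff)
    then show "x = y" using xy h(1) \<theta>0 by (auto simp: f_def inj_on_def split: if_splits)
  qed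
  moreover have "f ` universe N \<subseteq> V" using fS fU S by blast
  ultimately have bij: "bij_betw f (universe N) V"
    using N finite_universe by (simp add: bij_betw_def card_image card_subset_eq)
  have "isomorphic L N M"
    unfolding isomorphic_def
  proof (intro exI[of _ f] conjI allI impI bij, elim conjE)
    fix i w assume w: "i < length L" "length w = L ! i" "set w \<subseteq> universe N"
    define B where "B = set w - g ` S"
    have B: "finite B" "B \<subseteq> universe N" "B \<subseteq> universe N - g ` S" "set w \<subseteq> g ` S \<union> B"
      using w(3) by (auto simp: B_def)
    have cB: "card B \<le> k"
    proof -
      have "card B \<le> card (set w)" unfolding B_def by (intro card_mono) auto
      then show ?thesis using card_length[of w] w(2) arity_le[OF w(1)] by simp
    qed
    obtain \<theta> where \<theta>: "inj_on \<theta> (g ` S \<union> B)" "\<theta> ` (g ` S \<union> B) \<subseteq> V"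
      "\<And>s. s \<in> S \<Longrightarrow> \<theta> (g s) = s"
      "\<And>i w. i < length L \<Longrightarrow> length w = L ! i \<Longrightarrow> set w \<subseteq> g ` S \<union> B \<Longrightarrow>
        rel N i w = rel M i (map \<theta> w)"
      using emb[unfolded locally_embeds_def] B(1,2) cB by metis
    have "rel N i w = rel M i (map \<theta> w)" using \<theta>(4) w B(4) by blast
    also have "\<dots> = rel M i (map (\<lambda>x. if x \<in> g ` S then \<theta> x else h x) w)"
      by (rule agree[OF B(3) cB \<theta>(1,2) _ _ w(1,2) B(4)]) (use \<theta>(3,4) in auto)
    also have "map (\<lambda>x. if x \<in> g ` S then \<theta> x else h x) w = map f w"
      using \<theta>(3) \<theta>0 by (auto simp: f_def)
    finally show "rel N i w = rel M i (map f w)" .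
  qed
  then show ?thesis by (rule isomorphic_sym)
qed

text \<open>The type over \<open>S\<close> of the image of an unnamed \<open>x\<close> is dictated
  by \<open>N\<close>, so when types are distinct all local embeddings send \<open>x\<close> to the
  same element \<open>h x\<close>.\<close>

lemma locally_determined_distinct_types:
  assumes N: "finite (universe N)" "card (universe N) = card V"
    and "k \<ge> 2" and S: "S \<subseteq> V" and inj: "inj_on (tp S) (V - S)"
    and g: "g ` S \<subseteq> universe N" and emb: "locally_embeds L k S g N M"
  shows "isomorphic L M N"
proof -
  define E where "E B \<theta> \<longleftrightarrow> inj_on \<theta> (g ` S \<union> B) \<and> \<theta> ` (g ` S \<union> B) \<subseteq> V \<and>
      (\<forall>s \<in> S. \<theta> (g s) = s) \<and>
      (\<forall>i < length L. \<forall>w. length w = L ! i \<and> set w \<subseteq> g ` S \<union> B \<longrightarrow>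
          rel N i w = rel M i (map \<theta> w))" for B \<theta>
  have ex: "\<exists>\<theta>. E B \<theta>" if "finite B" "B \<subseteq> universe N" "card B \<le> k" for B
    unfolding E_def
    by (rule spec[OF emb[unfolded locally_embeds_def], THEN mp, OF conjI[OF that(1) conjI[OF that(2,3)]]])
  have out: "\<theta> x \<in> V - S" if "E B \<theta>" "x \<in> B - g ` S" for B \<theta> x
  proof -
    have "\<theta> x \<in> V" using that by (auto simp: E_def)
    moreover have "\<theta> x \<noteq> s" if s: "s \<in> S" for s
    proof
      assume "\<theta> x = s"
      then have "\<theta> x = \<theta> (g s)" using \<open>E B \<theta>\<close> s by (simp add: E_def)
      then have "x = g s" using \<open>E B \<theta>\<close> \<open>x \<in> B - g ` S\<close> s by (auto simp: E_def dest: inj_onD)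
      then show False using \<open>x \<in> B - g ` S\<close> s by blast
    qed
    ultimately show ?thesis by blast
  qed
  have same: "\<theta> x = \<theta>' x" if E: "E B \<theta>" "E B' \<theta>'" and x: "x \<in> B - g ` S" "x \<in> B' - g ` S"
    for B B' \<theta> \<theta>' x
  proof -
    have key: "rel N i (map (case_option x g) w) = rel M i (map (case_option (\<theta> x) id) w)"
      if "E B \<theta>" "x \<in> B" "i < length L" "length w = L ! i" "set w \<subseteq> insert None (Some ` S)"
      for B \<theta> i w
    proof -
      have "set (map (case_option x g) w) \<subseteq> g ` S \<union> B"
        using that(2,5) by auto
      moreover have "map \<theta> (map (case_option x g) w) = map (case_option (\<theta> x) id) w"
        using that(1,5) by (auto simp: E_def split: option.split)
      ultimately show ?thesis using that(1,3,4) unfolding E_def by (metis length_map)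
    qed
    have "tp S (\<theta> x) = tp S (\<theta>' x)"
      using key[OF E(1)] key[OF E(2)] x by (auto simp: type_over_def)
    then show ?thesis by (rule inj_onD[OF inj _ out[OF E(1) x(1)] out[OF E(2) x(2)]])
  qed
  define h where "h x = (SOME \<theta>. E {x} \<theta>) x" for x
  have Eh: "E {x} (SOME \<theta>. E {x} \<theta>)" if "x \<in> universe N" for x
  proof -
    have "\<exists>\<theta>. E {x} \<theta>" by (rule ex) (use that assms(3) in auto)
    then show ?thesis by (rule someI_ex)
  qed
  have \<theta>h: "\<theta> x = h x" if "E B \<theta>" "x \<in> B - g ` S" "x \<in> universe N" for B \<theta> x
    unfolding h_def by (rule same[OF that(1) Eh[OF that(3)] that(2)]) (use that(2) in auto)
  show ?thesis
  proof (rule isomorphic_if_locally_embeds[OF N S g emb, of h])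
    show "inj_on h (universe N - g ` S)"
    proof (rule inj_onI)
      fix x y assume xy: "x \<in> universe N - g ` S" "y \<in> universe N - g ` S" "h x = h y"
      \<comment> \<open>Injectivity of \<open>h\<close> needs one embedding covering both points,
        hence \<open>k \<ge> 2\<close>.\<close>
      have "card {x, y} \<le> 2" by (simp add: card_insert_if)
      then have "card {x, y} \<le> k" using assms(3) by simp
      with ex[of "{x, y}"] xy obtain \<theta> where \<theta>: "E {x, y} \<theta>" by auto
      have "\<theta> x = h x" "\<theta> y = h y" by (rule \<theta>h[OF \<theta>]; use xy in simp)+
      then have "\<theta> x = \<theta> y" using xy(3) by simp
      moreover have "inj_on \<theta> (g ` S \<union> {x, y})" using \<theta> unfolding E_def by (rule conjunct1)
      ultimately show "x = y" by (simp add: inj_on_eq_iff)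
    qed
    show "h ` (universe N - g ` S) \<subseteq> V - S"
      unfolding h_def using out[OF Eh] by blast
    fix B \<theta> i w
    assume B: "B \<subseteq> universe N - g ` S"
      and "inj_on \<theta> (g ` S \<union> B)" "\<theta> ` (g ` S \<union> B) \<subseteq> V" "\<And>s. s \<in> S \<Longrightarrow> \<theta> (g s) = s"
      "\<And>i w. i < length L \<Longrightarrow> length w = L ! i \<Longrightarrow> set w \<subseteq> g ` S \<union> B \<Longrightarrow>
          rel N i w = rel M i (map \<theta> w)"
      and w: "set w \<subseteq> g ` S \<union> B"
    then have "E B \<theta>" unfolding E_def by (intro conjI ballI allI impI) simp_all
    then have "map \<theta> w = map (\<lambda>x. if x \<in> g ` S then \<theta> x else h x) w"
      using B w \<theta>h by (intro map_cong refl) (auto simp: subset_iff)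
    then show "rel M i (map \<theta> w) = rel M i (map (\<lambda>x. if x \<in> g ` S then \<theta> x else h x) w)"
      by (rule arg_cong)
  qed
qed

text \<open>Any bijection \<open>h\<close> between the unnamed elements works: it differs from a
  local embedding by an injection that moves only elements of \<open>V - S\<close>, which the
  relations do not notice by \<open>rel_exchange\<close>.\<close>

lemma locally_determined_twin_class:
  assumes N: "finite (universe N)" "card (universe N) = card V"
    and S: "S \<subseteq> V"
    and transp: "\<And>i w a b. i < length L \<Longrightarrow> length w = L ! i \<Longrightarrow> set w \<subseteq> V \<Longrightarrow>
      a \<in> V - S \<Longrightarrow> b \<in> V - S \<Longrightarrow> rel M i w = rel M i (map (transpose a b) w)"
    and g: "g ` S \<subseteq> universe N" and emb: "locally_embeds L k S g N M"
  shows "isomorphic L M N"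
proof -
  obtain \<theta>0 where \<theta>0: "\<And>s. s \<in> S \<Longrightarrow> \<theta>0 (g s) = s"
    using emb[unfolded locally_embeds_def, rule_format, of "{}"] by auto
  have finS: "finite S" using S finite_universe by (rule finite_subset)
  have "inj_on g S" using \<theta>0 by (metis inj_onI)
  then have "card (universe N - g ` S) = card (V - S)"
    using N g S finS by (simp add: card_Diff_subset card_image)
  then obtain h where h: "bij_betw h (universe N - g ` S) (V - S)"
    using N(1) finite_universe by (metis finite_Diff finite_same_card_bij)
  show ?thesis
  proof (rule isomorphic_if_locally_embeds[OF N S g emb])
    show "inj_on h (universe N - g ` S)" "h ` (universe N - g ` S) \<subseteq> V - S"
      using h by (auto simp: bij_betw_def)
    fix B \<theta> i w
    assume B: "B \<subseteq> universe N - g ` S"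
      and \<theta>: "inj_on \<theta> (g ` S \<union> B)" "\<theta> ` (g ` S \<union> B) \<subseteq> V" "\<And>s. s \<in> S \<Longrightarrow> \<theta> (g s) = s"
      and w: "i < length L" "length w = L ! i" "set w \<subseteq> g ` S \<union> B"
    define f where "f x = (if x \<in> g ` S then \<theta> x else h x)" for x
    define \<pi> where "\<pi> = f \<circ> inv_into (g ` S \<union> B) \<theta>"
    have \<pi>: "\<pi> (\<theta> x) = f x" if "x \<in> g ` S \<union> B" for x
      using that \<theta>(1) by (simp add: \<pi>_def)
    have fS: "f x \<in> S" if "x \<in> g ` S" for x using that \<theta>(3) by (auto simp: f_def)
    have fB: "f x \<in> V - S" if "x \<in> B" for x
      using that B h by (auto simp: f_def bij_betw_def)
    have \<theta>B: "\<theta> x \<in> V - S" if x: "x \<in> B" for x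
    proof -
      have "\<theta> x \<noteq> s" if s: "s \<in> S" for s
      proof
        assume "\<theta> x = s"
        then have "\<theta> x = \<theta> (g s)" using \<theta>(3) s by simp
        then have "x = g s" using \<theta>(1) x s by (auto dest: inj_onD)
        then show False using x B s by blast
      qed
      then show ?thesis using x \<theta>(2) by blast
    qed
    have injf: "inj_on f (g ` S \<union> B)"
    proof (rule inj_onI)
      fix x y assume xy: "x \<in> g ` S \<union> B" "y \<in> g ` S \<union> B" "f x = f y"
      then have "x \<in> g ` S \<longleftrightarrow> y \<in> g ` S" using fS fB by (metis Diff_iff UnE)
      show "x = y"
      proof (cases "x \<in> g ` S")
        case True
        then have "\<theta> x = \<theta> y" using xy \<open>x \<in> g ` S \<longleftrightarrow> y \<in> g ` S\<close> by (simp add: f_def)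
        then show ?thesis by (rule inj_onD[OF \<theta>(1) _ xy(1,2)])
      next
        case False
        then have "h x = h y" using xy(3) \<open>x \<in> g ` S \<longleftrightarrow> y \<in> g ` S\<close> by (simp add: f_def)
        moreover have "x \<in> universe N - g ` S" "y \<in> universe N - g ` S"
          using xy(1,2) False \<open>x \<in> g ` S \<longleftrightarrow> y \<in> g ` S\<close> B by auto
        ultimately show ?thesis using h by (meson bij_betw_imp_inj_on inj_onD)
      qed
    qed
    have \<theta>w: "\<exists>x \<in> g ` S \<union> B. z = \<theta> x" if "z \<in> set (map \<theta> w)" for z
      using that w(3) unfolding set_map by (metis imageE subsetD)
    have "rel M i (map \<theta> w) = rel M i (map \<pi> (map \<theta> w))"
    proof (rule rel_exchange[of "V - S"])
      show "V - S \<subseteq> V" by blast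
      show "rel M i w = rel M i (map (transpose a b) w)"
        if "length w = L ! i" "set w \<subseteq> V" "a \<in> V - S" "b \<in> V - S" for w a b
        by (rule transp[OF w(1) that])
      show "length (map \<theta> w) = L ! i" using w(2) by simp
      show "set (map \<theta> w) \<subseteq> V" using \<theta>(2) w(3) unfolding set_map by (meson image_mono order_trans)
      show "inj_on \<pi> (set (map \<theta> w))"
      proof (rule inj_onI)
        fix a b assume ab: "a \<in> set (map \<theta> w)" "b \<in> set (map \<theta> w)" "\<pi> a = \<pi> b"
        then obtain x y where xy: "x \<in> g ` S \<union> B" "a = \<theta> x" "y \<in> g ` S \<union> B" "b = \<theta> y"
          using \<theta>w by meson
        then have "f x = f y" using ab(3) \<pi> by simp
        then have "x = y" by (rule inj_onD[OF injf _ xy(1,3)])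
        then show "a = b" using xy(2,4) by simp
      qed
      fix x assume x: "x \<in> set (map \<theta> w)" "\<pi> x \<noteq> x"
      then obtain y where y: "y \<in> g ` S \<union> B" "x = \<theta> y" using \<theta>w by meson
      have "y \<notin> g ` S" using x(2) \<pi>[OF y(1)] y(2) by (auto simp: f_def)
      then have "y \<in> B" using y by blast
      then show "x \<in> V - S \<and> \<pi> x \<in> V - S" using fB \<theta>B y \<pi> by auto
    qed
    also have "map \<pi> (map \<theta> w) = map f w"
    proof -
      have "(\<pi> \<circ> \<theta>) x = f x" if "x \<in> set w" for x
        using \<pi>[OF subsetD[OF w(3) that]] by simp
      then show ?thesis unfolding map_map by (rule map_cong[OF refl])
    qed
    finally show "rel M i (map \<theta> w) = rel M i (map (\<lambda>x. if x \<in> g ` S then \<theta> x else h x) w)"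
      unfolding f_def[abs_def] .
  qed
qed

section \<open>Choice of the unnamed set\<close>

text \<open>Take one representative of each type over \<open>X\<close>. They stay distinguished over
  \<open>V - U\<close>, which contains \<open>X\<close>.\<close>

lemma ex_distinct_types:
  assumes "X \<subseteq> V"
  obtains U where "U \<subseteq> V" "card U = ntypes X" "inj_on (tp (V - U)) U"
proof -
  obtain U where U: "U \<subseteq> V - X" "tp X ` U = tp X ` (V - X)" "inj_on (tp X) U"
    using subset_image_inj[of "tp X ` (V - X)" "tp X" "V - X"] by (metis order_refl)
  have "card U = ntypes X" using U card_image by (metis ntypes_def)
  moreover have "inj_on (tp (V - U)) U"
  proof (rule inj_onI)
    fix x y assume "x \<in> U" "y \<in> U" "tp (V - U) x = tp (V - U) y"
    moreover have "X \<subseteq> V - U" using U(1) assms by blast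
    ultimately show "x = y" using U(3) type_over_antimono by (metis inj_onD)
  qed
  ultimately show ?thesis using that U(1) by blast
qed

text \<open>Apply \<open>ex_refining_set\<close> with \<open>d = k - 1\<close>. Outside the refining
  set there are at most \<open>s\<close> classes; were all of size at most \<open>s + 1\<close>, the
  universe would be too small.\<close>

lemma ex_large_twin_class:
  fixes s :: real
  assumes k: "k \<ge> 2" and s: "s = sqrt (card V) - real k ^ 2" "s \<ge> k"
    and bound: "\<forall>Y \<subseteq> V. real (ntypes Y) \<le> s"
  obtains C where "C \<subseteq> V" "real (card C) > s + 1"
    "\<forall>A a b. A \<subseteq> V \<and> card A \<le> k - 1 \<and> a \<in> C - A \<and> b \<in> C - A \<longrightarrow>
      tp A a = tp A b"
proof -
  \<comment> \<open>The type counts are natural numbers, so the real bound \<open>s\<close> may be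
    rounded down.\<close>
  define u where "u = nat \<lfloor>s\<rfloor>"
  have s0: "s \<ge> 0" using s(2) by linarith
  have u: "real u \<le> s" using s0 by (simp add: u_def)
  have "\<forall>Y \<subseteq> V. ntypes Y \<le> u" using bound by (simp add: u_def le_nat_floor)
  then obtain X where X: "X \<subseteq> V" "card X \<le> 2 * (k - 1) * u * (k - 1)"
    "\<And>A a b. A \<subseteq> V \<Longrightarrow> card A \<le> k - 1 \<Longrightarrow> a \<in> V - (X \<union> A) \<Longrightarrow> b \<in> V - (X \<union> A) \<Longrightarrow>
      tp X a = tp X b \<Longrightarrow> tp A a = tp A b"
    using ex_refining_set[of u "k - 1"] by meson
  define fib where "fib t = {b \<in> V - X. tp X b = t}" for t
  have "\<exists>t. real (card (fib t)) > s + 1"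
  proof (rule ccontr)
    assume "\<not> ?thesis"
    then have small: "real (card (fib t)) \<le> s + 1" for t by (meson not_le)
    have finX: "finite (V - X)" using finite_universe by simp
    have "V - X = (\<Union>t \<in> tp X ` (V - X). fib t)" by (auto simp: fib_def)
    then have "card (V - X) \<le> (\<Sum>t \<in> tp X ` (V - X). card (fib t))"
      using card_UN_le[of "tp X ` (V - X)" fib] finX by simp
    then have "real (card (V - X)) \<le> (\<Sum>t \<in> tp X ` (V - X). real (card (fib t)))"
      by (metis of_nat_le_iff of_nat_sum)
    also have "\<dots> \<le> real (ntypes X) * (s + 1)"
      unfolding ntypes_def by (rule sum_bounded_above) (rule small)
    also have "\<dots> \<le> s * (s + 1)" using bound X(1) s0 by (intro mult_right_mono) auto
    finally have 1: "real (card (V - X)) \<le> s * (s + 1)" .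
    have "real (card X) \<le> real (2 * (k - 1) * u * (k - 1))" using X(2) of_nat_le_iff by blast
    also have "\<dots> = 2 * (real k - 1) ^ 2 * real u"
      using k by (simp add: power2_eq_square of_nat_diff)
    also have "\<dots> \<le> 2 * (real k - 1) ^ 2 * s" using u by (intro mult_left_mono) auto
    finally have 2: "real (card X) \<le> 2 * (real k - 1) ^ 2 * s" .
    have "card V = card X + card (V - X)"
      using X(1) finite_universe by (metis card_Diff_subset card_mono finite_subset le_add_diff_inverse)
    with 1 2 have 3: "real (card V) \<le> s * (s + 1 + 2 * (real k - 1) ^ 2)"
      by (simp add: algebra_simps)
    define t where "t = sqrt (card V)"
    have t: "real (card V) = t ^ 2" "s = t - real k ^ 2" using s(1) by (auto simp: t_def)
    \<comment> \<open>The choice \<open>s = t - k^2\<close> makes the second factor at most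
      \<open>t + k^2\<close>, so the product is at most \<open>t^2 - k^4\<close>, below the order
      \<open>t^2\<close>.\<close>
    have "s + 1 + 2 * (real k - 1) ^ 2 = t + real k ^ 2 - 4 * real k + 3"
      by (simp add: t(2) power2_eq_square algebra_simps)
    also have "\<dots> \<le> t + real k ^ 2" using k by simp
    finally have "s * (s + 1 + 2 * (real k - 1) ^ 2) \<le> s * (t + real k ^ 2)"
      using s0 by (rule mult_left_mono)
    also have "\<dots> = t ^ 2 - real k ^ 4"
      unfolding t(2) by (simp add: power2_eq_square power4_eq_xxxx algebra_simps)
    also have "\<dots> < t ^ 2" using k by simp
    finally show False using 3 t(1) by simp
  qed
  then obtain t where t: "real (card (fib t)) > s + 1" by blast
  show ?thesis
  proof (rule that[of "fib t"])
    show "fib t \<subseteq> V" by (auto simp: fib_def)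
    show "real (card (fib t)) > s + 1" by (rule t)
  qed (use X(3) in \<open>auto simp: fib_def\<close>)
qed

end

subsection \<open>The two bounds\<close>

lemma BS_less_if_large_order:
  fixes M :: "nat struct"
  assumes "has_max_arity L k" "has_order M n" "k \<ge> 2" "sqrt n \<ge> real k ^ 2 + real k"
  shows "real (BS k L M) < real n - sqrt n + real k ^ 2 + real k"
proof -
  interpret finite_structure L M k
  proof
    show "finite (universe M)" using assms(2) by (simp add: has_order_def)
    show "L ! i \<le> k" if "i < length L" for i
      using assms(1) that by (auto simp: has_max_arity_def)
  qed
  define s where "s = sqrt n - real k ^ 2"
  have n: "card V = n" using assms(2) by (simp add: has_order_def)
  have "sqrt n > 0" using assms(3,4) by (smt (verit) of_nat_0_less_iff power2_less_0 zero_less_numeral le_neq_implies_less not_numeral_le_zero gr0I)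
  then have n1: "n \<ge> 1" by (cases n) auto
  \<comment> \<open>Naming all but \<open>U\<close> costs fewer than \<open>n - s\<close>
    existential quantifiers, and \<open>k\<close> universal ones are added.\<close>
  have suffices: "real (BS k L M) < real n - sqrt n + real k ^ 2 + real k"
    if U: "U \<subseteq> V" "real (card U) > s"
      and det: "\<And>(N :: nat struct) g. has_order N n \<Longrightarrow> g ` (V - U) \<subseteq> universe N \<Longrightarrow>
        locally_embeds L k (V - U) g N M \<Longrightarrow> isomorphic L M N" for U
  proof -
    have "BS k L M \<le> card (V - U) + k"
      by (rule BS_le_if_locally_determined(2)[OF assms(2) n1]) (use det in auto)
    moreover have "card (V - U) + card U = n"
      using U(1) n finite_universe by (metis card_Diff_subset card_mono finite_subset le_add_diff_inverse2)
    ultimately have "real (BS k L M) + real (card U) \<le> real n + real k" by linarith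
    then show ?thesis using U(2) by (simp add: s_def)
  qed
  show ?thesis
  proof (cases "\<exists>X \<subseteq> V. real (ntypes X) > s")
    case True
    then obtain X where X: "X \<subseteq> V" "real (ntypes X) > s" by blast
    obtain U where U: "U \<subseteq> V" "card U = ntypes X" "inj_on (tp (V - U)) U"
      using ex_distinct_types[OF X(1)] .
    have VU: "V - (V - U) = U" using U(1) by blast
    show ?thesis
    proof (rule suffices[OF U(1)])
      show "s < real (card U)" using X U by simp
      fix N :: "nat struct" and g
      assume "has_order N n" "g ` (V - U) \<subseteq> universe N" "locally_embeds L k (V - U) g N M"
      then show "isomorphic L M N"
        using locally_determined_distinct_types[of N "V - U" g] assms(3) U(3) n
        by (simp add: has_order_def VU)
    qed
  next
    case False
    then have bound: "\<forall>Y \<subseteq> V. real (ntypes Y) \<le> s" by (meson not_le)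
    have sk: "s \<ge> k" using assms(4) by (simp add: s_def)
    obtain C where C: "C \<subseteq> V" "real (card C) > s + 1"
      "\<forall>A a b. A \<subseteq> V \<and> card A \<le> k - 1 \<and> a \<in> C - A \<and> b \<in> C - A \<longrightarrow>
      tp A a = tp A b"
      using ex_large_twin_class[OF assms(3) _ sk bound] by (metis n s_def)
    have VC: "V - (V - C) = C" using C(1) by blast
    have kC: "card C > k" using C(2) sk by linarith
    show ?thesis
    proof (rule suffices[OF C(1)])
      show "s < real (card C)" using C(2) by simp
      fix N :: "nat struct" and g
      assume N: "has_order N n" "g ` (V - C) \<subseteq> universe N" "locally_embeds L k (V - C) g N M"
      show "isomorphic L M N"
      proof (rule locally_determined_twin_class[OF _ _ _ _ N(2,3)])
        show "finite (universe N)" "card (universe N) = card V"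
          using N(1) n by (simp_all add: has_order_def)
        fix i w a b
        assume "i < length L" "length w = L ! i" "set w \<subseteq> V"
          "a \<in> V - (V - C)" "b \<in> V - (V - C)"
        then show "rel M i w = rel M i (map (transpose a b) w)"
          using rel_transpose[OF C(1) kC C(3)] unfolding VC by metis
      qed blast
    qed
  qed
qed

text \<open>A binary relation is presented as a \<open>k\<close>-ary one that reads only the first two entries, so
  that one symbol of arity \<open>k\<close> suffices.\<close>

definition binary_struct :: "'a set \<Rightarrow> ('a \<Rightarrow> 'a \<Rightarrow> bool) \<Rightarrow> 'a struct" where
  "binary_struct V E = \<lparr>universe = V, rel = (\<lambda>i w. E (w ! 0) (w ! 1))\<rparr>"

lemma universe_binary_struct [simp]: "universe (binary_struct V E) = V"
  by (simp add: binary_struct_def)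

lemma isomorphic_binary_structD:
  assumes "isomorphic [k] (binary_struct V E) (binary_struct V' E')" "k \<ge> 2"
  obtains f where "bij_betw f V V'" "\<And>a b. a \<in> V \<Longrightarrow> b \<in> V \<Longrightarrow> E a b \<longleftrightarrow> E' (f a) (f b)"
proof -
  obtain f where f: "bij_betw f V V'"
    "\<And>as. length as = k \<Longrightarrow> set as \<subseteq> V \<Longrightarrow> E (as ! 0) (as ! 1) = E' (map f as ! 0) (map f as ! 1)"
    using assms(1) by (auto simp: isomorphic_def binary_struct_def)
  have "E a b \<longleftrightarrow> E' (f a) (f b)" if "a \<in> V" "b \<in> V" for a b
  proof -
    obtain j where "k = Suc (Suc j)" using assms(2) by (metis Suc_le_D numeral_2_eq_2 Suc_le_mono)
    \<comment> \<open>Entries beyond the second are padding.\<close>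
    then show ?thesis using f(2)[of "a # b # replicate j a"] that
      by (simp add: set_replicate_conv_if)
  qed
  then show ?thesis using that f(1) by metis
qed

lemma isomorphic_binary_struct_degree:
  assumes "isomorphic [k] (binary_struct V E) (binary_struct V' E')" "k \<ge> 2"
    and deg: "\<forall>a \<in> V. card {b \<in> V. E a b} = d" and "a' \<in> V'"
  shows "card {b \<in> V'. E' a' b} = d"
proof -
  obtain f where f: "bij_betw f V V'" "\<And>a b. a \<in> V \<Longrightarrow> b \<in> V \<Longrightarrow> E a b \<longleftrightarrow> E' (f a) (f b)"
    using isomorphic_binary_structD[OF assms(1,2)] by metis
  obtain a where a: "a \<in> V" "a' = f a" using f(1) assms(4) by (auto simp: bij_betw_def)
  have "{b \<in> V'. E' a' b} = f ` {b \<in> V. E a b}"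
    using f a by (auto simp: bij_betw_def)
  moreover have "inj_on f {b \<in> V. E a b}" using f(1) by (auto simp: bij_betw_def inj_on_def)
  ultimately show ?thesis using deg a(1) by (simp add: card_image)
qed

lemma locally_embeds_binary_struct:
  assumes "k \<ge> 2"
    and "\<And>B. finite B \<Longrightarrow> B \<subseteq> V \<Longrightarrow> card B \<le> r \<Longrightarrow>
      \<exists>\<theta>. inj_on \<theta> (S \<union> B) \<and> \<theta> ` (S \<union> B) \<subseteq> V \<and> (\<forall>s \<in> S. \<theta> s = s) \<and>
        (\<forall>x \<in> S \<union> B. \<forall>y \<in> S \<union> B. E' x y \<longleftrightarrow> E (\<theta> x) (\<theta> y))"
  shows "locally_embeds [k] r S id (binary_struct V E') (binary_struct V E)"
  unfolding locally_embeds_def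
proof (intro allI impI, elim conjE)
  fix B assume "finite B" "B \<subseteq> universe (binary_struct V E')" "card B \<le> r"
  then obtain \<theta> where \<theta>: "inj_on \<theta> (S \<union> B)" "\<theta> ` (S \<union> B) \<subseteq> V" "\<forall>s \<in> S. \<theta> s = s"
    "\<And>x y. x \<in> S \<union> B \<Longrightarrow> y \<in> S \<union> B \<Longrightarrow> E' x y \<longleftrightarrow> E (\<theta> x) (\<theta> y)"
    using assms(2)[of B] by auto
  have "E' (w ! 0) (w ! 1) \<longleftrightarrow> E (map \<theta> w ! 0) (map \<theta> w ! 1)"
    if "length w = k" "set w \<subseteq> S \<union> B" for w
  proof -
    have "0 < length w" "1 < length w" using assms(1) that(1) by auto
    then show ?thesis using \<theta>(4)[of "w ! 0" "w ! 1"] that(2) nth_mem by (simp add: subset_iff)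
  qed
  then show "\<exists>\<theta>. inj_on \<theta> (id ` S \<union> B) \<and> \<theta> ` (id ` S \<union> B) \<subseteq> universe (binary_struct V E) \<and>
    (\<forall>s\<in>S. \<theta> (id s) = s) \<and>
    (\<forall>i<length [k]. \<forall>w. length w = [k] ! i \<and> set w \<subseteq> id ` S \<union> B \<longrightarrow>
      rel (binary_struct V E') i w = rel (binary_struct V E) i (map \<theta> w))"
    using \<theta>(1-3) by (intro exI[of _ \<theta>]) (simp add: binary_struct_def)
qed

section \<open>Disjoint cliques\<close>

lemma card_div_fibre:
  fixes m d :: nat
  assumes "m > 0" "d < m"
  shows "card {b \<in> {..<m * m}. b div m = d} = m"
proof -
  have "{b \<in> {..<m * m}. b div m = d} = {d * m..<Suc d * m}" (is "?A = ?B")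
  proof
    show "?A \<subseteq> ?B" using assms(1)
      by (auto simp: dividend_less_times_div mult.commute)
    show "?B \<subseteq> ?A"
    proof
      fix b assume b: "b \<in> ?B"
      then have "b div m = d" using assms(1) by (intro div_nat_eqI) (auto simp: mult.commute)
      moreover have "Suc d * m \<le> m * m" using assms(2) by (intro mult_le_mono1) simp
      ultimately show "b \<in> ?A" using b by auto
    qed
  qed
  then show ?thesis by simp
qed

text \<open>Vertices are the numbers below \<open>m * m\<close>, and \<open>div m\<close> gives the
  clique. Too few quantifiers leave so many vertices unnamed that some competitor locally embeds in
  \<open>M\<close> but has a vertex of the wrong degree. The bound \<open>few\<close> is stated
  additively to avoid truncated subtraction.\<close>

lemma not_identified_cliques:
  fixes m q k p r :: nat
  defines "M \<equiv> binary_struct {..<m * m} (\<lambda>a b. a div m = b div m)"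
  assumes m: "m \<ge> 2" and q: "q \<ge> 2" and k: "k \<ge> 2" and r: "r \<le> q"
    and few: "p + r + (q - 1) * m < m * m + q" and \<phi>: "bs_formula [k] p r \<phi>"
  shows "\<not> identifies [k] \<phi> M"
proof
  assume id: "identifies [k] \<phi> M"
  let ?V = "{..<m * m}"
  obtain S where S: "S \<subseteq> ?V" "finite S" "card S \<le> p"
    "\<And>N. S \<subseteq> universe N \<Longrightarrow> locally_embeds [k] r S id N M \<Longrightarrow> true_on N \<phi>"
    using bs_formula_true_on_locally_embeds[OF \<phi>, of M] id
    by (auto simp: identifies_def M_def)
  define U where "U = ?V - S"
  have "card U = m * m - card S" unfolding U_def using S by (simp add: card_Diff_subset)
  then have cU: "card U + p \<ge> m * m" using S(3) by linarith
  have div: "b div m < m" if "b \<in> ?V" for b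
    using that by (simp add: less_mult_imp_div_less)
  have finU: "finite U" by (simp add: U_def)
  have deg: "\<forall>a \<in> ?V. card {b \<in> ?V. a div m = b div m} = m"
    using card_div_fibre[of m] div m by (simp add: eq_commute)
  \<comment> \<open>In \<open>M\<close> every vertex is related to exactly \<open>m\<close>
    vertices, itself included.\<close>
  have contra: False
    if w: "w \<in> ?V" "card {b \<in> ?V. E w b} \<noteq> m"
      and emb: "locally_embeds [k] r S id (binary_struct ?V E) M" for E w
  proof -
    have "\<not> isomorphic [k] M (binary_struct ?V E)"
      using isomorphic_binary_struct_degree[OF _ k deg w(1)] w(2) unfolding M_def by blast
    moreover have "true_on (binary_struct ?V E) \<phi>" using S(4)[OF _ emb] S(1) by simp
    ultimately show False using id by (auto simp: identifies_def has_order_def M_def)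
  qed
  \<comment> \<open>The competitor moves \<open>v\<close> into clique \<open>d\<close>. If
    \<open>v\<close> is in \<open>B\<close>, then \<open>B\<close> has at most \<open>r - 1\<close>
    other elements, so an unnamed vertex of clique \<open>d\<close> outside \<open>B\<close> can
    stand in for \<open>v\<close>.\<close>
  have relocate: False
    if v: "v \<in> U" and d: "d < m" "d \<noteq> v div m" "card {b \<in> U. b div m = d} \<ge> r" for v d
  proof -
    define c where "c x = (if x = v then d else x div m)" for x
    \<comment> \<open>The first vertex of clique \<open>d\<close>; it gains the neighbour
      \<open>v\<close>.\<close>
    define w where "w = d * m"
    have "d * m < m * m" using d(1) by simp
    then have w: "w \<in> ?V" "w div m = d" "w \<noteq> v" using d m by (auto simp: w_def)
    have "{b \<in> ?V. c w = c b} = insert v {b \<in> ?V. b div m = d}"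
      using v w d by (auto simp: c_def U_def)
    then have "card {b \<in> ?V. c w = c b} = Suc m"
      using card_div_fibre[of m d] m d by simp
    moreover have "locally_embeds [k] r S id (binary_struct ?V (\<lambda>a b. c a = c b)) M"
      unfolding M_def
    proof (rule locally_embeds_binary_struct[OF k])
      fix B assume B: "finite B" "B \<subseteq> ?V" "card B \<le> r"
      show "\<exists>\<theta>. inj_on \<theta> (S \<union> B) \<and> \<theta> ` (S \<union> B) \<subseteq> ?V \<and> (\<forall>s \<in> S. \<theta> s = s) \<and>
        (\<forall>x \<in> S \<union> B. \<forall>y \<in> S \<union> B. c x = c y \<longleftrightarrow> \<theta> x div m = \<theta> y div m)"
      proof (cases "v \<in> B")
        case False
        then show ?thesis using v B S(1)
          by (intro exI[of _ id]) (auto simp: c_def U_def)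
      next
        case True
        have "card (B - {v}) < r" using True B card_Suc_Diff1[OF B(1) True] by linarith
        then have "\<not> {b \<in> U. b div m = d} \<subseteq> B - {v}"
          using d(3) B(1) card_mono[of "B - {v}" "{b \<in> U. b div m = d}"] by auto
        then obtain w' where w': "w' \<in> U" "w' div m = d" "w' \<notin> B" using d(2) by auto
        define \<theta> where "\<theta> x = (if x = v then w' else x)" for x
        have "inj_on \<theta> (S \<union> B)" using w' by (auto simp: \<theta>_def inj_on_def U_def)
        moreover have "\<theta> ` (S \<union> B) \<subseteq> ?V" using w' B S(1) by (auto simp: \<theta>_def U_def)
        moreover have "\<forall>s \<in> S. \<theta> s = s" using v by (auto simp: \<theta>_def U_def)
        moreover have "c x = \<theta> x div m" for x using w'(2) by (simp add: c_def \<theta>_def)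
        ultimately show ?thesis by (intro exI[of _ \<theta>]) simp
      qed
    qed
    ultimately show False using contra[OF w(1)] by fastforce
  qed
  \<comment> \<open>With at most one universal variable, \<open>v\<close> and \<open>w\<close> never
    both lie in \<open>S \<union> B\<close>, so the identity embeds the structure without the edge
    between them.\<close>
  have split_pair: False
    if vw: "v \<in> U" "w \<in> U" "v \<noteq> w" "v div m = w div m" and r1: "r \<le> 1" for v w
  proof -
    define E where "E a b \<longleftrightarrow> a div m = b div m \<and> {a, b} \<noteq> {v, w}" for a b
    have "{b \<in> ?V. E w b} = {b \<in> ?V. w div m = b div m} - {v}"
      using vw by (auto simp: E_def)
    moreover have "v \<in> {b \<in> ?V. w div m = b div m}" using vw by (simp add: U_def)
    ultimately have "card {b \<in> ?V. E w b} = m - 1"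
      using deg vw(2) by (simp add: U_def)
    then have "card {b \<in> ?V. E w b} \<noteq> m" using m by simp
    moreover have "locally_embeds [k] r S id (binary_struct ?V E) M"
      unfolding M_def
    proof (rule locally_embeds_binary_struct[OF k])
      fix B assume B: "finite B" "B \<subseteq> ?V" "card B \<le> r"
      have "\<not> {v, w} \<subseteq> B"
      proof
        assume "{v, w} \<subseteq> B"
        then have "card {v, w} \<le> card B" using B(1) by (rule card_mono[rotated])
        then show False using B(3) r1 vw(3) by simp
      qed
      then have "\<not> {v, w} \<subseteq> S \<union> B" using vw by (auto simp: U_def)
      then have "{x, y} \<noteq> {v, w}" if "x \<in> S \<union> B" "y \<in> S \<union> B" for x y
        using that by (metis empty_subsetI insert_subset)
      then show "\<exists>\<theta>. inj_on \<theta> (S \<union> B) \<and> \<theta> ` (S \<union> B) \<subseteq> ?V \<and> (\<forall>s \<in> S. \<theta> s = s) \<and>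
        (\<forall>x \<in> S \<union> B. \<forall>y \<in> S \<union> B. E x y \<longleftrightarrow> \<theta> x div m = \<theta> y div m)"
        using B(2) S(1) by (intro exI[of _ id]) (auto simp: E_def)
    qed
    ultimately show False using contra vw(2) by (auto simp: U_def)
  qed
  obtain q' m' where qm: "q = Suc (Suc q')" "m = Suc (Suc m')"
    using q m by (metis add_2_eq_Suc le_Suc_ex)
  consider "r = 0" | "r = 1" | "r \<ge> 2" by linarith
  then show False
  proof cases
    case 1
    have "card U > 0" using few cU 1 by (simp add: qm algebra_simps)
    then obtain v where "v \<in> U" by (metis card_gt_0_iff ex_in_conv)
    moreover obtain d where "d < m" "d \<noteq> v div m"
      using m by (metis less_le_trans pos2 one_less_numeral_iff semiring_norm(76) zero_neq_one)
    ultimately show False using relocate 1 by blast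
  next
    case 2
    have "card U \<ge> 2" using few cU 2 by (simp add: qm algebra_simps)
    then obtain v w where vw: "v \<in> U" "w \<in> U" "v \<noteq> w"
      by (metis card_le_Suc0_iff_eq finU not_less_eq_eq numeral_2_eq_2)
    show False
    proof (cases "v div m = w div m")
      case True
      then show False using split_pair vw 2 by simp
    next
      case False
      have "w \<in> {b \<in> U. b div m = w div m}" using vw by simp
      then have "card {b \<in> U. b div m = w div m} \<ge> 1"
        using finU by (metis (no_types, lifting) One_nat_def Suc_leI card_gt_0_iff empty_iff finite_Collect_conjI finite_subset mem_Collect_eq subsetI)
      moreover have "w div m < m" using vw div by (simp add: U_def)
      ultimately show False using relocate[OF vw(1), of "w div m"] False 2 by simp
    qed
  next
    case 3
    \<comment> \<open>From \<open>few\<close>, \<open>card U\<close> exceeds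
      \<open>(r - 1) * m + (q - r) * (m - 1)\<close>. By pigeonhole some clique has \<open>r\<close>
      unnamed vertices, and since \<open>r \<ge> 2\<close> they are not all of
      \<open>U\<close>.\<close>
    have "(r - 1) * m < card U"
    proof -
      obtain x where x: "q = r + x" using r le_Suc_ex by blast
      obtain y where y: "r = Suc y" using 3 by (cases r) auto
      show ?thesis using few cU by (simp add: x y qm(2) algebra_simps)
    qed
    have "\<exists>d < m. card {b \<in> U. b div m = d} \<ge> r"
    proof (rule ccontr)
      assume "\<not> ?thesis"
      then have small: "card {b \<in> U. b div m = d} \<le> r - 1" if "d \<in> {..<m}" for d
        using that by force
      have "U = (\<Union>d<m. {b \<in> U. b div m = d})" using div by (auto simp: U_def)
      then have "card U \<le> (\<Sum>d<m. card {b \<in> U. b div m = d})"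
        using card_UN_le[of "{..<m}" "\<lambda>d. {b \<in> U. b div m = d}"] by simp
      also have "\<dots> \<le> m * (r - 1)"
        using sum_bounded_above[of "{..<m}" _ "r - 1"] small by fastforce
      finally show False using \<open>(r - 1) * m < card U\<close> by (simp add: mult.commute)
    qed
    then obtain d where d: "d < m" "card {b \<in> U. b div m = d} \<ge> r" by blast
    have "card {b \<in> ?V. b div m = d} < card U"
    proof -
      have "1 * m \<le> (r - 1) * m" using 3 by (intro mult_le_mono1) linarith
      moreover have "card {b \<in> ?V. b div m = d} = m" using m d(1) by (intro card_div_fibre) simp_all
      ultimately show ?thesis using \<open>(r - 1) * m < card U\<close> by linarith
    qed
    then have "\<not> U \<subseteq> {b \<in> ?V. b div m = d}" by (metis (no_types, lifting) card_mono finite_Collect_conjI finite_lessThan not_le finite_subset mem_Collect_eq subsetI)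
    then obtain v where "v \<in> U" "d \<noteq> v div m" by (auto simp: U_def)
    then show False using relocate d by blast
  qed
qed

section \<open>Maxima over all structures of a given order\<close>

lemma finite_BS_values:
  assumes "n \<ge> 1"
  shows "finite {BS q L M | L (M :: nat struct).
    vocabulary L \<and> has_max_arity L k \<and> has_order M n}"
  by (rule finite_subset[of _ "{..n}"]) (auto intro: BS_le_order[OF _ assms])

text \<open>For \<open>n = 1\<close> the second bound would be 2, while \<open>BS\<close> is at most
  \<open>n\<close>. For \<open>k = 1\<close> and \<open>n \<ge> 4\<close> the first bound fails: if
  unary predicates give all elements different types, one universal variable does not notice an
  unnamed element taking the type of another, so \<open>n\<close> quantifiers are needed.\<close>

theorem theorem6p2:
  fixes n k :: nat
  assumes "n \<ge> 1" and "k \<ge> 1"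
  shows "(k \<ge> 2 \<or> n < 4 \<longrightarrow>
            real (BS_max k n k) < real n - sqrt (real n) + real k ^ 2 + real k) \<and>
         (\<forall>q :: nat. q \<ge> 2 \<and> k \<ge> 2 \<and> n > 1 \<and> (\<exists>m :: nat. n = m ^ 2) \<longrightarrow>
            real (BS_max q n k) \<ge> real n - (real q - 1) * sqrt (real n) + real q)"
proof (intro conjI impI allI)
  assume kn: "k \<ge> 2 \<or> n < 4"
  let ?A = "{BS k L M | L (M :: nat struct). vocabulary L \<and> has_max_arity L k \<and> has_order M n}"
  have "vocabulary [k]" "has_max_arity [k] k" using assms(2)
    by (auto simp: vocabulary_def has_max_arity_def)
  moreover have "has_order (binary_struct {..<n} (\<lambda>_ _. True)) n" by (simp add: has_order_def)
  ultimately have "?A \<noteq> {}" by blast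
  then have "BS_max k n k \<in> ?A"
    unfolding BS_max_def by (intro Max_in finite_BS_values assms(1))
  then obtain L and M :: "nat struct" where LM: "BS_max k n k = BS k L M"
    "has_max_arity L k" "has_order M n" by blast
  show "real (BS_max k n k) < real n - sqrt (real n) + real k ^ 2 + real k"
  proof (cases "sqrt n \<ge> real k ^ 2 + real k")
    \<comment> \<open>For small \<open>n\<close> the right-hand side exceeds \<open>n\<close>, and
      naming every element suffices.\<close>
    case False
    moreover have "real (BS k L M) \<le> real n" using BS_le_order[OF LM(3) assms(1)] by simp
    ultimately show ?thesis using LM(1) by simp
  next
    case True
    \<comment> \<open>For \<open>k = 1\<close> the case assumption reads
      \<open>sqrt n \<ge> 2\<close>, against \<open>n < 4\<close>.\<close>
    have "k \<ge> 2"
    proof (rule ccontr)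
      assume "\<not> k \<ge> 2"
      then have "k = 1" "n < 4" using assms(2) kn by auto
      then have "sqrt n < sqrt 4" by (subst real_sqrt_less_iff) simp
      then show False using True \<open>k = 1\<close> by simp
    qed
    then show ?thesis using BS_less_if_large_order[OF LM(2,3) _ True] LM(1) by simp
  qed
next
  fix q :: nat
  assume "q \<ge> 2 \<and> k \<ge> 2 \<and> n > 1 \<and> (\<exists>m :: nat. n = m ^ 2)"
  then obtain m :: nat where q: "q \<ge> 2" and k: "k \<ge> 2" and n: "n > 1" "n = m ^ 2" by blast
  have m: "m \<ge> 2"
  proof (rule ccontr)
    assume "\<not> m \<ge> 2"
    then have "m = 0 \<or> m = 1" by auto
    then show False using n by auto
  qed
  define M where "M = binary_struct {..<m * m} (\<lambda>a b. a div m = b div m)"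
  have M: "has_order M n" by (simp add: M_def has_order_def n(2) power2_eq_square)
  obtain p r \<phi> where BS: "BS q [k] M = p + r" "r \<le> q" "bs_formula [k] p r \<phi>"
    "identifies [k] \<phi> M" using BS_attained[OF M assms(1)] .
  have "\<not> p + r + (q - 1) * m < m * m + q"
    using not_identified_cliques[OF m q k BS(2) _ BS(3)] BS(4) by (auto simp: M_def)
  then have "real (p + r + (q - 1) * m) \<ge> real (m * m + q)" using of_nat_le_iff not_le by blast
  then have "real (p + r) \<ge> real n - (real q - 1) * real m + real q"
    using q by (simp add: n(2) of_nat_diff power2_eq_square)
  moreover have "real m = sqrt n" by (simp add: n(2))
  moreover have "BS q [k] M \<le> BS_max q n k"
  proof -
    have "vocabulary [k]" "has_max_arity [k] k" using k
      by (auto simp: vocabulary_def has_max_arity_def)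
    then show ?thesis unfolding BS_max_def using M
      by (intro Max_ge finite_BS_values assms(1)) blast
  qed
  ultimately show "real (BS_max q n k) \<ge> real n - (real q - 1) * sqrt (real n) + real q"
    using BS(1) by simp
qed

end
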